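(* Let $k$ be a field. Each of the six functors $\mathfrak{F}^{1}\colon \mathrm{rep}(\mathcal{S},k)\to\mathrm{rep}(\mathcal{F},k)$, $\mathfrak{F}^{2}\colon \mathrm{rep}(\mathcal{D},k)\to\mathrm{rep}(\mathcal{F},k)$, $\mathfrak{F}^{3}\colon \mathrm{rep}(\mathcal{K},k)\to\mathrm{rep}(\mathcal{F},k)$, $\mathfrak{F}^{4}\colon \mathrm{rep}(\mathcal{C},k)\to\mathrm{rep}(\mathcal{F},k)$, $\mathfrak{F}^{5}\colon \mathrm{lrel}(k)\to\mathrm{rep}(\mathcal{F},k)$ and $\mathfrak{F}^{6}\colon \mathrm{lrel}^{2}_{2}(k)\to\mathrm{rep}(\mathcal{F},k)$ is fully faithful.
   Context: Throughout, $k$ is a field and all vector spaces are finite-dimensional over $k$; $\mathrm{rep}(Q,k)$ denotes the category of finite-dimensional representations over $k$ of a quiver $Q$. Quivers. $\mathcal{F}$: vertices $0,1,2,3,4$, arrows $\alpha\colon 1\to 0$, $\beta\colon 2\to 0$, $\gamma\colon 3\to 0$, $\delta\colon 4\to 0$; its representations are written $(V_0,V_1,V_2,V_3,V_4,f_\alpha,f_\beta,f_\gamma,f_\delta)$ and its morphisms $(l_0,l_1,l_2,l_3,l_4)$. $\mathcal{S}$: vertices $1,2,3,4$, arrows $\alpha\colon 3\to 1$, $\beta\colon 3\to 2$, $\gamma\colon 4\to 1$, $\delta\colon 4\to 2$. $\mathcal{D}$: vertices $1,2,3$, arrows $\alpha\colon 3\to 1$, $\beta\colon 3\to 2$, $\gamma\colon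 2\to 1$. $\mathcal{K}$: vertices $1,2$, arrows $\alpha,\beta\colon 2\to 1$. $\mathcal{C}$: vertices $1,2$, arrows $\alpha\colon 2\to 1$, $\beta\colon 1\to 2$. Linear relations. $\mathrm{lrel}(k)$: objects $\rho=(V_1,R)$ with $V_1$ a vector space and $R\subseteq V_1\oplus V_1$ a subspace; a morphism $(V_1,R)\to(W_1,S)$ is a linear map $l\colon V_1\to W_1$ such that $(x,y)\in R$ implies $(l(x),l(y))\in S$. $\mathrm{lrel}^2_2(k)$: objects $\rho=(V_1,V_2,R_1,R_2)$ with $R_1,R_2\subseteq V_1\oplus V_2$ subspaces; a morphism to $(W_1,W_2,S_1,S_2)$ is a pair of linear maps $l_i\colon V_i\to W_i$ such that $(x,y)\in R_i$ implies $(l_1(x),l_2(y))\in S_i$ for $i=1,2$. Functors. In each case below except $\mathfrak{F}^5$, $V_0=V_1\oplus V_2$ and $\iota_i\colon V_i\to V_0$ are the canonical inclusions. - $\mathfrak{F}^1(V)=(V_0,V_1,V_2,V_3,V_4,\iota_1,\iota_2,\iota_1f_\alpha+\iota_2f_\beta,\iota_1f_\gamma+\iota_2f_\delta)$, $\mathfrak{F}^1(l)=(l_1\oplus l_2,l_1,l_2,l_3,l_4)$. - $\mathfrak{F}^2(V)=(V_0,V_1,V_2,V_3,V_2,\iota_1,\iota_2,\iota_1f_\alpha+\iota_2f_\beta,\iota_1f_\gamma+\iota_2)$, $\mathfrak{F}^2(l)=(l_1\oplus l_2,l_1,l_2,l_3,l_2)$. - $\mathfrak{F}^3(V)=(V_0,V_1,V_2,V_2,V_2,\iota_1,\iota_2,\iota_1f_\alpha+\iota_2,\iota_1f_\beta+\iota_2)$,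 $\mathfrak{F}^3(l)=(l_1\oplus l_2,l_1,l_2,l_2,l_2)$. - $\mathfrak{F}^4(V)=(V_0,V_1,V_2,V_1,V_2,\iota_1,\iota_2,\iota_1+\iota_2f_\beta,\iota_1f_\alpha+\iota_2)$, $\mathfrak{F}^4(l)=(l_1\oplus l_2,l_1,l_2,l_1,l_2)$. - $\mathfrak{F}^5(V_1,R)=(V_1\oplus V_1,V_1,V_1,V_1,R,\iota_1,\iota_2,\iota_1+\iota_2,j)$ with $\iota_1,\iota_2\colon V_1\to V_1\oplus V_1$ the two canonical inclusions and $j\colon R\to V_1\oplus V_1$ the inclusion; $\mathfrak{F}^5(l)=(l\oplus l,l,l,l,(l\oplus l)|_R)$. - $\mathfrak{F}^6(V_1,V_2,R_1,R_2)=(V_0,V_1,V_2,R_1,R_2,\iota_1,\iota_2,j_1,j_2)$ with $j_i\colon R_i\to V_0$ the inclusions; $\mathfrak{F}^6(l)=(l_1\oplus l_2,l_1,l_2,(l_1\oplus l_2)|_{R_1},(l_1\oplus l_2)|_{R_2})$. *)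

theory Defs
  imports "Jordan_Normal_Form.Missing_VectorSpace" "Graph_Theory.Digraph"
begin

section \<open>Categories and fully faithful functors\<close>

text \<open>
  Composition takes its three objects as explicit arguments: morphisms are (families of)
  functions, which do not record their source and target. \<open>Comp C A B D g f\<close> is \<open>g \<circ> f\<close>
  for \<open>f : A \<rightarrow> B\<close> and \<open>g : B \<rightarrow> D\<close>.
\<close>

record ('o, 'm) category =
  Obj :: "'o set"
  Hom :: "'o \<Rightarrow> 'o \<Rightarrow> 'm set"
  Ident :: "'o \<Rightarrow> 'm"
  Comp :: "'o \<Rightarrow> 'o \<Rightarrow> 'o \<Rightarrow> 'm \<Rightarrow> 'm \<Rightarrow> 'm"

locale category =
  fixes C :: "('o, 'm) category"
  assumes ident_in_Hom: "A \<in> Obj C \<Longrightarrow> Ident C A \<in> Hom C A A"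
    and comp_in_Hom:
      "\<lbrakk>A \<in> Obj C; B \<in> Obj C; D \<in> Obj C; f \<in> Hom C A B; g \<in> Hom C B D\<rbrakk>
        \<Longrightarrow> Comp C A B D g f \<in> Hom C A D"
    and comp_ident_left:
      "\<lbrakk>A \<in> Obj C; B \<in> Obj C; f \<in> Hom C A B\<rbrakk> \<Longrightarrow> Comp C A B B (Ident C B) f = f"
    and comp_ident_right:
      "\<lbrakk>A \<in> Obj C; B \<in> Obj C; f \<in> Hom C A B\<rbrakk> \<Longrightarrow> Comp C A A B f (Ident C A) = f"
    and comp_assoc:
      "\<lbrakk>A \<in> Obj C; B \<in> Obj C; D \<in> Obj C; E \<in> Obj C;
        f \<in> Hom C A B; g \<in> Hom C B D; h \<in> Hom C D E\<rbrakk>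
        \<Longrightarrow> Comp C A D E h (Comp C A B D g f) = Comp C A B E (Comp C B D E h g) f"

text \<open>\<open>on_mor F A B\<close> is the action of \<open>F\<close> on morphisms \<open>A \<rightarrow> B\<close>.\<close>

record ('o, 'm, 'p, 'n) fun_data =
  on_obj :: "'o \<Rightarrow> 'p"
  on_mor :: "'o \<Rightarrow> 'o \<Rightarrow> 'm \<Rightarrow> 'n"

locale cat_functor = source: category C + target: category D
  for C :: "('o, 'm) category" and D :: "('p, 'n) category" +
  fixes F :: "('o, 'm, 'p, 'n) fun_data"
  assumes obj: "A \<in> Obj C \<Longrightarrow> on_obj F A \<in> Obj D"
    and mor: "\<lbrakk>A \<in> Obj C; B \<in> Obj C; f \<in> Hom C A B\<rbrakk>
      \<Longrightarrow> on_mor F A B f \<in> Hom D (on_obj F A) (on_obj F B)"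
    and ident: "A \<in> Obj C \<Longrightarrow> on_mor F A A (Ident C A) = Ident D (on_obj F A)"
    and comp: "\<lbrakk>A \<in> Obj C; B \<in> Obj C; E \<in> Obj C; f \<in> Hom C A B; g \<in> Hom C B E\<rbrakk>
      \<Longrightarrow> on_mor F A E (Comp C A B E g f)
        = Comp D (on_obj F A) (on_obj F B) (on_obj F E) (on_mor F B E g) (on_mor F A B f)"

locale fully_faithful_functor = cat_functor +
  assumes fully_faithful:
    "\<lbrakk>A \<in> Obj C; B \<in> Obj C\<rbrakk>
      \<Longrightarrow> bij_betw (on_mor F A B) (Hom C A B) (Hom D (on_obj F A) (on_obj F B))"


section \<open>Vector spaces\<close>

text \<open>
  The elements of all vector spaces are drawn from one type that is closed under pairing, so
  that the direct sum of two spaces is again a space over the same type, and each of the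
  categories below has a single type of objects. Any vector space over a type \<open>'v\<close> is one over
  \<open>'v univ\<close>, via \<open>Base\<close>.
\<close>

datatype 'v univ = Base 'v | UPair (ufst: "'v univ") (usnd: "'v univ")

definition fd_vectorspace :: "('a, 'c) ring_scheme \<Rightarrow> ('a, 'u) module \<Rightarrow> bool" where
  "fd_vectorspace k V \<longleftrightarrow> vectorspace k V \<and> vectorspace.fin_dim k V"

text \<open>Linear maps are required to be \<open>undefined\<close> off the carrier, so that equality of
  functions is equality of linear maps.\<close>

definition lin_maps :: "('a, 'c) ring_scheme \<Rightarrow> ('a, 'u) module \<Rightarrow> ('a, 'w) module \<Rightarrow> ('u \<Rightarrow> 'w) set"
  where "lin_maps k V W = LinearCombinations.module_hom k V W \<inter> extensional (carrier V)"

definition id_map :: "('a, 'u) module \<Rightarrow> 'u \<Rightarrow> 'u" where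
  "id_map V = (\<lambda>x\<in>carrier V. x)"

definition add_map :: "('a, 'u) module \<Rightarrow> ('a, 'w) module \<Rightarrow> ('u \<Rightarrow> 'w) \<Rightarrow> ('u \<Rightarrow> 'w) \<Rightarrow> 'u \<Rightarrow> 'w" where
  "add_map V W f g = (\<lambda>x\<in>carrier V. f x \<oplus>\<^bsub>W\<^esub> g x)"

text \<open>This is \<^const>\<open>direct_sum\<close> with \<^const>\<open>UPair\<close> in place of \<^const>\<open>Pair\<close>; as there, the
  ring multiplication that the record type carries is immaterial.\<close>

definition dirsum :: "('a, 'v univ) module \<Rightarrow> ('a, 'v univ) module \<Rightarrow> ('a, 'v univ) module" where
  "dirsum V W =
    \<lparr>carrier = {UPair x y | x y. x \<in> carrier V \<and> y \<in> carrier W},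
     mult = (\<lambda>_ _. UPair \<zero>\<^bsub>V\<^esub> \<zero>\<^bsub>W\<^esub>),
     one = UPair \<zero>\<^bsub>V\<^esub> \<zero>\<^bsub>W\<^esub>,
     zero = UPair \<zero>\<^bsub>V\<^esub> \<zero>\<^bsub>W\<^esub>,
     add = (\<lambda>p q. UPair (ufst p \<oplus>\<^bsub>V\<^esub> ufst q) (usnd p \<oplus>\<^bsub>W\<^esub> usnd q)),
     smult = (\<lambda>c p. UPair (c \<odot>\<^bsub>V\<^esub> ufst p) (c \<odot>\<^bsub>W\<^esub> usnd p))\<rparr>"

definition incl1 :: "('a, 'v univ) module \<Rightarrow> ('a, 'v univ) module \<Rightarrow> 'v univ \<Rightarrow> 'v univ" where
  "incl1 V W = (\<lambda>x\<in>carrier V. UPair x \<zero>\<^bsub>W\<^esub>)"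

definition incl2 :: "('a, 'v univ) module \<Rightarrow> ('a, 'v univ) module \<Rightarrow> 'v univ \<Rightarrow> 'v univ" where
  "incl2 V W = (\<lambda>y\<in>carrier W. UPair \<zero>\<^bsub>V\<^esub> y)"

definition dirsum_map ::
  "('a, 'v univ) module \<Rightarrow> ('a, 'v univ) module \<Rightarrow> ('v univ \<Rightarrow> 'v univ) \<Rightarrow> ('v univ \<Rightarrow> 'v univ)
    \<Rightarrow> 'v univ \<Rightarrow> 'v univ" where
  "dirsum_map V W f g = (\<lambda>p\<in>carrier (dirsum V W). UPair (f (ufst p)) (g (usnd p)))"

text \<open>A subspace, regarded as a vector space in its own right.\<close>

definition subsp :: "('a, 'u) module \<Rightarrow> 'u set \<Rightarrow> ('a, 'u) module" where
  "subsp V R = V\<lparr>carrier := R\<rparr>"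


section \<open>Representations of quivers\<close>

text \<open>A quiver is a directed multigraph, \<^typ>\<open>('q, 'r) pre_digraph\<close>; an arc \<open>a\<close> points from
  \<^term>\<open>tail Q a\<close> to \<^term>\<open>head Q a\<close>.\<close>

record ('q, 'r, 'a, 'u) quiver_rep =
  space :: "'q \<Rightarrow> ('a, 'u) module"
  arrow_map :: "'r \<Rightarrow> 'u \<Rightarrow> 'u"

definition rep :: "('q, 'r) pre_digraph \<Rightarrow> ('a, 'c) ring_scheme
    \<Rightarrow> (('q, 'r, 'a, 'u) quiver_rep, 'q \<Rightarrow> 'u \<Rightarrow> 'u) category" where
  "rep Q k =
    \<lparr>Obj = {V. space V \<in> verts Q \<rightarrow>\<^sub>E {M. fd_vectorspace k M} \<and>
               arrow_map V \<in> (\<Pi>\<^sub>E a\<in>arcs Q. lin_maps k (space V (tail Q a)) (space V (head Q a)))},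
     Hom = (\<lambda>V W. {l \<in> (\<Pi>\<^sub>E i\<in>verts Q. lin_maps k (space V i) (space W i)).
               \<forall>a\<in>arcs Q. \<forall>x\<in>carrier (space V (tail Q a)).
                 l (head Q a) (arrow_map V a x) = arrow_map W a (l (tail Q a) x)}),
     Ident = (\<lambda>V. \<lambda>i\<in>verts Q. id_map (space V i)),
     Comp = (\<lambda>U V W g f. \<lambda>i\<in>verts Q. compose (carrier (space U i)) (g i) (f i))\<rparr>"

datatype arrow = \<alpha> | \<beta> | \<gamma> | \<delta>

definition quiver_F :: "(nat, arrow) pre_digraph" where
  "quiver_F = \<lparr>verts = {0, 1, 2, 3, 4}, arcs = {\<alpha>, \<beta>, \<gamma>, \<delta>},
     tail = (\<lambda>_. undefined)(\<alpha> := 1, \<beta> := 2, \<gamma> := 3, \<delta> := 4),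
     head = (\<lambda>_. undefined)(\<alpha> := 0, \<beta> := 0, \<gamma> := 0, \<delta> := 0)\<rparr>"

definition quiver_S :: "(nat, arrow) pre_digraph" where
  "quiver_S = \<lparr>verts = {1, 2, 3, 4}, arcs = {\<alpha>, \<beta>, \<gamma>, \<delta>},
     tail = (\<lambda>_. undefined)(\<alpha> := 3, \<beta> := 3, \<gamma> := 4, \<delta> := 4),
     head = (\<lambda>_. undefined)(\<alpha> := 1, \<beta> := 2, \<gamma> := 1, \<delta> := 2)\<rparr>"

definition quiver_D :: "(nat, arrow) pre_digraph" where
  "quiver_D = \<lparr>verts = {1, 2, 3}, arcs = {\<alpha>, \<beta>, \<gamma>},
     tail = (\<lambda>_. undefined)(\<alpha> := 3, \<beta> := 3, \<gamma> := 2),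
     head = (\<lambda>_. undefined)(\<alpha> := 1, \<beta> := 2, \<gamma> := 1)\<rparr>"

definition quiver_K :: "(nat, arrow) pre_digraph" where
  "quiver_K = \<lparr>verts = {1, 2}, arcs = {\<alpha>, \<beta>},
     tail = (\<lambda>_. undefined)(\<alpha> := 2, \<beta> := 2),
     head = (\<lambda>_. undefined)(\<alpha> := 1, \<beta> := 1)\<rparr>"

definition quiver_C :: "(nat, arrow) pre_digraph" where
  "quiver_C = \<lparr>verts = {1, 2}, arcs = {\<alpha>, \<beta>},
     tail = (\<lambda>_. undefined)(\<alpha> := 2, \<beta> := 1),
     head = (\<lambda>_. undefined)(\<alpha> := 1, \<beta> := 2)\<rparr>"

text \<open>The tuple notations \<open>(V\<^sub>0, \<dots>, V\<^sub>4, f\<^sub>\<alpha>, \<dots>, f\<^sub>\<delta>)\<close> and \<open>(l\<^sub>0, \<dots>, l\<^sub>4)\<close> for objects and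
  morphisms of \<open>rep quiver_F k\<close>.\<close>

definition mk_rep_F where
  "mk_rep_F V0 V1 V2 V3 V4 fa fb fc fd =
    \<lparr>space = (\<lambda>_. undefined)(0 := V0, 1 := V1, 2 := V2, 3 := V3, 4 := V4),
     arrow_map = (\<lambda>_. undefined)(\<alpha> := fa, \<beta> := fb, \<gamma> := fc, \<delta> := fd)\<rparr>"

definition mk_mor_F :: "'l \<Rightarrow> 'l \<Rightarrow> 'l \<Rightarrow> 'l \<Rightarrow> 'l \<Rightarrow> nat \<Rightarrow> 'l" where
  "mk_mor_F l0 l1 l2 l3 l4 = (\<lambda>_. undefined)(0 := l0, 1 := l1, 2 := l2, 3 := l3, 4 := l4)"


section \<open>Linear relations\<close>

text \<open>In these categories \<open>(x, y) \<in> R\<close> is written \<open>UPair x y \<in> R\<close>.\<close>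

definition lrel :: "('a, 'c) ring_scheme
    \<Rightarrow> (('a, 'v univ) module \<times> 'v univ set, 'v univ \<Rightarrow> 'v univ) category" where
  "lrel k =
    \<lparr>Obj = {(V, R). fd_vectorspace k V \<and> VectorSpace.subspace k R (dirsum V V)},
     Hom = (\<lambda>(V, R) (W, S). {l \<in> lin_maps k V W.
               \<forall>x y. UPair x y \<in> R \<longrightarrow> UPair (l x) (l y) \<in> S}),
     Ident = (\<lambda>(V, R). id_map V),
     Comp = (\<lambda>(U, P) (V, R) (W, S) g f. compose (carrier U) g f)\<rparr>"

definition lrel22 :: "('a, 'c) ring_scheme
    \<Rightarrow> (('a, 'v univ) module \<times> ('a, 'v univ) module \<times> 'v univ set \<times> 'v univ set,
        ('v univ \<Rightarrow> 'v univ) \<times> ('v univ \<Rightarrow> 'v univ)) category" where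
  "lrel22 k =
    \<lparr>Obj = {(V1, V2, R1, R2). fd_vectorspace k V1 \<and> fd_vectorspace k V2 \<and>
               VectorSpace.subspace k R1 (dirsum V1 V2) \<and> VectorSpace.subspace k R2 (dirsum V1 V2)},
     Hom = (\<lambda>(V1, V2, R1, R2) (W1, W2, S1, S2).
               {(l1, l2). l1 \<in> lin_maps k V1 W1 \<and> l2 \<in> lin_maps k V2 W2 \<and>
                 (\<forall>x y. UPair x y \<in> R1 \<longrightarrow> UPair (l1 x) (l2 y) \<in> S1) \<and>
                 (\<forall>x y. UPair x y \<in> R2 \<longrightarrow> UPair (l1 x) (l2 y) \<in> S2)}),
     Ident = (\<lambda>(V1, V2, R1, R2). (id_map V1, id_map V2)),
     Comp = (\<lambda>(U1, U2, P1, P2) (V1, V2, R1, R2) (W1, W2, S1, S2) (g1, g2) (f1, f2).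
               (compose (carrier U1) g1 f1, compose (carrier U2) g2 f2))\<rparr>"


section \<open>The six functors\<close>

text \<open>For a subspace \<open>R\<close> of \<open>V0\<close>, the inclusion \<open>R \<rightarrow> V0\<close> is \<open>id_map (subsp V0 R)\<close>.\<close>

type_synonym ('a, 'v) nat_rep = "(nat, arrow, 'a, 'v univ) quiver_rep"
type_synonym 'v nat_mor = "nat \<Rightarrow> 'v univ \<Rightarrow> 'v univ"

definition F1 :: "(('a, 'v) nat_rep, 'v nat_mor, ('a, 'v) nat_rep, 'v nat_mor) fun_data" where
  "F1 =
    \<lparr>on_obj = (\<lambda>V.
       let V1 = space V 1; V2 = space V 2; V3 = space V 3; V4 = space V 4; V0 = dirsum V1 V2
       in mk_rep_F V0 V1 V2 V3 V4
         (incl1 V1 V2)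
         (incl2 V1 V2)
         (add_map V3 V0 (compose (carrier V3) (incl1 V1 V2) (arrow_map V \<alpha>))
                        (compose (carrier V3) (incl2 V1 V2) (arrow_map V \<beta>)))
         (add_map V4 V0 (compose (carrier V4) (incl1 V1 V2) (arrow_map V \<gamma>))
                        (compose (carrier V4) (incl2 V1 V2) (arrow_map V \<delta>)))),
     on_mor = (\<lambda>V W l.
       mk_mor_F (dirsum_map (space V 1) (space V 2) (l 1) (l 2)) (l 1) (l 2) (l 3) (l 4))\<rparr>"

definition F2 :: "(('a, 'v) nat_rep, 'v nat_mor, ('a, 'v) nat_rep, 'v nat_mor) fun_data" where
  "F2 =
    \<lparr>on_obj = (\<lambda>V.
       let V1 = space V 1; V2 = space V 2; V3 = space V 3; V0 = dirsum V1 V2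
       in mk_rep_F V0 V1 V2 V3 V2
         (incl1 V1 V2)
         (incl2 V1 V2)
         (add_map V3 V0 (compose (carrier V3) (incl1 V1 V2) (arrow_map V \<alpha>))
                        (compose (carrier V3) (incl2 V1 V2) (arrow_map V \<beta>)))
         (add_map V2 V0 (compose (carrier V2) (incl1 V1 V2) (arrow_map V \<gamma>))
                        (incl2 V1 V2))),
     on_mor = (\<lambda>V W l.
       mk_mor_F (dirsum_map (space V 1) (space V 2) (l 1) (l 2)) (l 1) (l 2) (l 3) (l 2))\<rparr>"

definition F3 :: "(('a, 'v) nat_rep, 'v nat_mor, ('a, 'v) nat_rep, 'v nat_mor) fun_data" where
  "F3 =
    \<lparr>on_obj = (\<lambda>V.
       let V1 = space V 1; V2 = space V 2; V0 = dirsum V1 V2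
       in mk_rep_F V0 V1 V2 V2 V2
         (incl1 V1 V2)
         (incl2 V1 V2)
         (add_map V2 V0 (compose (carrier V2) (incl1 V1 V2) (arrow_map V \<alpha>)) (incl2 V1 V2))
         (add_map V2 V0 (compose (carrier V2) (incl1 V1 V2) (arrow_map V \<beta>)) (incl2 V1 V2))),
     on_mor = (\<lambda>V W l.
       mk_mor_F (dirsum_map (space V 1) (space V 2) (l 1) (l 2)) (l 1) (l 2) (l 2) (l 2))\<rparr>"

definition F4 :: "(('a, 'v) nat_rep, 'v nat_mor, ('a, 'v) nat_rep, 'v nat_mor) fun_data" where
  "F4 =
    \<lparr>on_obj = (\<lambda>V.
       let V1 = space V 1; V2 = space V 2; V0 = dirsum V1 V2
       in mk_rep_F V0 V1 V2 V1 V2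
         (incl1 V1 V2)
         (incl2 V1 V2)
         (add_map V1 V0 (incl1 V1 V2) (compose (carrier V1) (incl2 V1 V2) (arrow_map V \<beta>)))
         (add_map V2 V0 (compose (carrier V2) (incl1 V1 V2) (arrow_map V \<alpha>)) (incl2 V1 V2))),
     on_mor = (\<lambda>V W l.
       mk_mor_F (dirsum_map (space V 1) (space V 2) (l 1) (l 2)) (l 1) (l 2) (l 1) (l 2))\<rparr>"

definition F5 :: "(('a, 'v univ) module \<times> 'v univ set, 'v univ \<Rightarrow> 'v univ,
    ('a, 'v) nat_rep, 'v nat_mor) fun_data" where
  "F5 =
    \<lparr>on_obj = (\<lambda>(V1, R).
       let V0 = dirsum V1 V1
       in mk_rep_F V0 V1 V1 V1 (subsp V0 R)
         (incl1 V1 V1)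
         (incl2 V1 V1)
         (add_map V1 V0 (incl1 V1 V1) (incl2 V1 V1))
         (id_map (subsp V0 R))),
     on_mor = (\<lambda>(V1, R) (W1, S) l.
       mk_mor_F (dirsum_map V1 V1 l l) l l l (restrict (dirsum_map V1 V1 l l) R))\<rparr>"

definition F6 :: "(('a, 'v univ) module \<times> ('a, 'v univ) module \<times> 'v univ set \<times> 'v univ set,
    ('v univ \<Rightarrow> 'v univ) \<times> ('v univ \<Rightarrow> 'v univ),
    ('a, 'v) nat_rep, 'v nat_mor) fun_data" where
  "F6 =
    \<lparr>on_obj = (\<lambda>(V1, V2, R1, R2).
       let V0 = dirsum V1 V2
       in mk_rep_F V0 V1 V2 (subsp V0 R1) (subsp V0 R2)
         (incl1 V1 V2)
         (incl2 V1 V2)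
         (id_map (subsp V0 R1))
         (id_map (subsp V0 R2))),
     on_mor = (\<lambda>(V1, V2, R1, R2) (W1, W2, S1, S2) (l1, l2).
       mk_mor_F (dirsum_map V1 V2 l1 l2) l1 l2
         (restrict (dirsum_map V1 V2 l1 l2) R1) (restrict (dirsum_map V1 V2 l1 l2) R2))\<rparr>"

end

theory Submission
  imports Defs
begin

text \<open>
  All six functors produce representations whose arrows \<open>\<alpha>\<close>, \<open>\<beta>\<close> are the inclusions into
  \<open>V\<^sub>1 \<oplus> V\<^sub>2\<close>. A morphism \<open>l\<close> between two such representations has \<open>l\<^sub>0 = l\<^sub>1 \<oplus> l\<^sub>2\<close>, so
  only its compatibility with \<open>\<gamma>\<close> and \<open>\<delta>\<close> is left. For an arrow \<open>\<iota>\<^sub>1f + \<iota>\<^sub>2g\<close> this splits into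
  compatibility with \<open>f\<close> and with \<open>g\<close>; when one of these is an identity it forces \<open>l\<^sub>3\<close> or \<open>l\<^sub>4\<close>
  to equal \<open>l\<^sub>1\<close> or \<open>l\<^sub>2\<close>. For the inclusion of a subspace \<open>R\<close> it says that the component is the
  restriction of \<open>l\<^sub>1 \<oplus> l\<^sub>2\<close>, hence exists exactly if \<open>l\<^sub>1 \<oplus> l\<^sub>2\<close> preserves the relations.
\<close>

text \<open>Keeps the vertex \<open>1\<close> a numeral: rewritten to \<open>Suc 0\<close>, it would
  no longer match the rules stated for \<open>1\<close>.\<close>

declare One_nat_def [simp del]

section \<open>Linear maps and finite-dimensional spaces\<close>

lemma lin_mapsI:
  assumes "\<And>x. x \<in> carrier V \<Longrightarrow> f x \<in> carrier W"
    and "\<And>x y. \<lbrakk>x \<in> carrier V; y \<in> carrier V\<rbrakk> \<Longrightarrow> f (x \<oplus>\<^bsub>V\<^esub> y) = f x \<oplus>\<^bsub>W\<^esub> f y"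
    and "\<And>c x. \<lbrakk>c \<in> carrier k; x \<in> carrier V\<rbrakk> \<Longrightarrow> f (c \<odot>\<^bsub>V\<^esub> x) = c \<odot>\<^bsub>W\<^esub> f x"
    and "f \<in> extensional (carrier V)"
  shows "f \<in> lin_maps k V W"
  using assms by (auto simp: lin_maps_def LinearCombinations.module_hom_def)

lemma lin_maps_closed: "\<lbrakk>f \<in> lin_maps k V W; x \<in> carrier V\<rbrakk> \<Longrightarrow> f x \<in> carrier W"
  by (auto simp: lin_maps_def LinearCombinations.module_hom_def)

lemma lin_maps_add:
  "\<lbrakk>f \<in> lin_maps k V W; x \<in> carrier V; y \<in> carrier V\<rbrakk> \<Longrightarrow> f (x \<oplus>\<^bsub>V\<^esub> y) = f x \<oplus>\<^bsub>W\<^esub> f y"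
  by (auto simp: lin_maps_def LinearCombinations.module_hom_def)

lemma lin_maps_smult:
  "\<lbrakk>f \<in> lin_maps k V W; c \<in> carrier k; x \<in> carrier V\<rbrakk> \<Longrightarrow> f (c \<odot>\<^bsub>V\<^esub> x) = c \<odot>\<^bsub>W\<^esub> f x"
  by (auto simp: lin_maps_def LinearCombinations.module_hom_def)

lemma lin_maps_extensional: "f \<in> lin_maps k V W \<Longrightarrow> f \<in> extensional (carrier V)"
  by (simp add: lin_maps_def)

lemma lin_maps_eqI:
  assumes "f \<in> lin_maps k V W" "g \<in> lin_maps k V W'"
    and "\<And>x. x \<in> carrier V \<Longrightarrow> f x = g x"
  shows "f = g"
  using assms by (meson extensionalityI lin_maps_extensional)

lemma lin_maps_compose:
  assumes "f \<in> lin_maps k U V" "g \<in> lin_maps k V W"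
    and "\<And>x y. \<lbrakk>x \<in> carrier U; y \<in> carrier U\<rbrakk> \<Longrightarrow> x \<oplus>\<^bsub>U\<^esub> y \<in> carrier U"
    and "\<And>c x. \<lbrakk>c \<in> carrier k; x \<in> carrier U\<rbrakk> \<Longrightarrow> c \<odot>\<^bsub>U\<^esub> x \<in> carrier U"
  shows "compose (carrier U) g f \<in> lin_maps k U W"
  using assms
  by (intro lin_mapsI) (simp_all add: compose_eq lin_maps_closed lin_maps_add lin_maps_smult)

section \<open>Closure and zero laws in finite-dimensional spaces\<close>

lemma fd_module: "fd_vectorspace k V \<Longrightarrow> Module.module k V"
  by (simp add: fd_vectorspace_def vectorspace_def)

lemma fd_zero: "fd_vectorspace k V \<Longrightarrow> \<zero>\<^bsub>V\<^esub> \<in> carrier V"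
  by (meson abelian_group.axioms(1) abelian_monoid.zero_closed fd_module module.axioms(2))

lemma fd_add:
  "\<lbrakk>fd_vectorspace k V; x \<in> carrier V; y \<in> carrier V\<rbrakk> \<Longrightarrow> x \<oplus>\<^bsub>V\<^esub> y \<in> carrier V"
  by (meson abelian_group.axioms(1) abelian_monoid.a_closed fd_module module.axioms(2))

lemma fd_smult:
  "\<lbrakk>fd_vectorspace k V; c \<in> carrier k; x \<in> carrier V\<rbrakk> \<Longrightarrow> c \<odot>\<^bsub>V\<^esub> x \<in> carrier V"
  by (meson fd_module module.smult_closed)

lemma fd_l_zero: "\<lbrakk>fd_vectorspace k V; x \<in> carrier V\<rbrakk> \<Longrightarrow> \<zero>\<^bsub>V\<^esub> \<oplus>\<^bsub>V\<^esub> x = x"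
  by (meson abelian_group.axioms(1) abelian_monoid.l_zero fd_module module.axioms(2))

lemma fd_r_zero: "\<lbrakk>fd_vectorspace k V; x \<in> carrier V\<rbrakk> \<Longrightarrow> x \<oplus>\<^bsub>V\<^esub> \<zero>\<^bsub>V\<^esub> = x"
  by (meson abelian_group.axioms(1) abelian_monoid.r_zero fd_module module.axioms(2))

lemma fd_smult_zero: "\<lbrakk>fd_vectorspace k V; c \<in> carrier k\<rbrakk> \<Longrightarrow> c \<odot>\<^bsub>V\<^esub> \<zero>\<^bsub>V\<^esub> = \<zero>\<^bsub>V\<^esub>"
  by (meson fd_module module.smult_r_null)

lemmas fd_simps = fd_zero fd_add fd_smult fd_l_zero fd_r_zero fd_smult_zero

lemma lin_maps_zero:
  assumes "fd_vectorspace k V" "fd_vectorspace k W" "f \<in> lin_maps k V W"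
  shows "f \<zero>\<^bsub>V\<^esub> = \<zero>\<^bsub>W\<^esub>"
  using assms by (intro mod_hom.f0_is_0[of k] mod_hom.intro mod_hom_axioms.intro)
    (simp_all add: fd_module lin_maps_def)

lemma fd_compose:
  "\<lbrakk>fd_vectorspace k U; f \<in> lin_maps k U V; g \<in> lin_maps k V W\<rbrakk>
    \<Longrightarrow> compose (carrier U) g f \<in> lin_maps k U W"
  by (rule lin_maps_compose) (simp_all add: fd_simps)

section \<open>Identities and composition of extensional linear maps\<close>

lemma id_map_lin: "fd_vectorspace k V \<Longrightarrow> id_map V \<in> lin_maps k V V"
  by (intro lin_mapsI) (simp_all add: id_map_def fd_simps)

lemma id_map_eq: "x \<in> carrier V \<Longrightarrow> id_map V x = x"
  by (simp add: id_map_def)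

lemma compose_id_left: "f \<in> lin_maps k V W \<Longrightarrow> compose (carrier V) (id_map W) f = f"
  by (intro extensionalityI[of _ "carrier V"])
    (auto simp: compose_eq id_map_def lin_maps_closed intro: lin_maps_extensional)

lemma compose_id_right: "f \<in> lin_maps k V W \<Longrightarrow> compose (carrier V) f (id_map V) = f"
  by (intro extensionalityI[of _ "carrier V"])
    (auto simp: compose_eq id_map_def intro: lin_maps_extensional)

lemma lin_compose_assoc:
  "f \<in> lin_maps k U V
    \<Longrightarrow> compose (carrier U) h (compose (carrier U) g f)
      = compose (carrier U) (compose (carrier V) h g) f"
  by (rule compose_assoc) (auto simp: lin_maps_closed)

text \<open>Used with the minimality of spans: if \<open>f\<close> sends a set into
  \<open>S\<close>, this submodule contains the whole span of that set. Preservation of zero is a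
  separate hypothesis because \<open>lin_maps_zero\<close> asks for a finite-dimensional
  \<open>W\<close>, whereas here \<open>W\<close> will be a direct sum whose finite dimension is
  still being proved.\<close>

lemma submodule_vimage:
  assumes fd: "fd_vectorspace k V" and f: "f \<in> lin_maps k V W"
    and S: "LinearCombinations.submodule k S W" and zero: "f \<zero>\<^bsub>V\<^esub> = \<zero>\<^bsub>W\<^esub>"
  shows "LinearCombinations.submodule k {x \<in> carrier V. f x \<in> S} V"
proof -
  interpret S: LinearCombinations.submodule k S W by (rule S)
  show ?thesis
    using fd f zero
    by (intro LinearCombinations.submodule.intro)
      (auto simp: fd_simps lin_maps_add lin_maps_smult fd_module)
qed

text \<open>Independent subsets of \<open>R\<close> stay independent in \<open>V\<close>, so their
  size is bounded by the dimension of \<open>V\<close>. Hence a maximal independent subset of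
  \<open>R\<close> exists, and it is a finite generating set.\<close>

lemma fd_subspace:
  assumes V: "fd_vectorspace k V" and R: "VectorSpace.subspace k R V"
  shows "fd_vectorspace k (subsp V R)"
proof -
  interpret V: vectorspace k V using V by (simp add: fd_vectorspace_def)
  have fd: "V.fin_dim" using V by (simp add: fd_vectorspace_def)
  have sub: "LinearCombinations.submodule k R V" using R by (simp add: VectorSpace.subspace_def)
  have RV: "R \<subseteq> carrier V" using sub by (simp add: LinearCombinations.submodule_def)
  have vsR: "vectorspace k (V\<lparr>carrier := R\<rparr>)" by (rule V.subspace_is_vs[OF R])
  interpret R: vectorspace k "V\<lparr>carrier := R\<rparr>" by (rule vsR)
  have "\<exists>B. finite B \<and> maximal B (\<lambda>S. S \<subseteq> R \<and> \<not> module.lin_dep k (V\<lparr>carrier := R\<rparr>) S)"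
  \<comment> \<open>A maximal set is obtained from a uniform bound on cardinality, here
    \<open>V.dim\<close>, and one set to start from, here the empty one.\<close>
  proof (rule maximal_exists[where B = "{}" and N = V.dim])
    fix A assume A: "A \<subseteq> R \<and> \<not> module.lin_dep k (V\<lparr>carrier := R\<rparr>) A"
    then have "\<not> module.lin_dep k V A"
      \<comment> \<open>Linear dependence inside the subspace agrees with linear dependence in
        \<open>V\<close>.\<close>
      using V.span_li_not_depend(2)[of A R] sub by blast
    then show "finite A \<and> card A \<le> V.dim"
      using V.li_le_dim[OF fd] A RV by blast
  next
    show "{} \<subseteq> R \<and> \<not> module.lin_dep k (V\<lparr>carrier := R\<rparr>) {}"
      by (auto simp: R.lin_dep_def)
  qed
  then obtain B where B: "finite B"
    "maximal B (\<lambda>S. S \<subseteq> carrier (V\<lparr>carrier := R\<rparr>) \<and> \<not> module.lin_dep k (V\<lparr>carrier := R\<rparr>) S)"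
    by auto
  have "R.fin_dim"
    unfolding R.fin_dim_def using B R.max_li_is_gen[OF B(2)] by (auto simp: maximal_def)
  then show ?thesis
    using vsR by (simp add: fd_vectorspace_def subsp_def)
qed

section \<open>Direct sums\<close>

lemma carrier_dirsum: "UPair x y \<in> carrier (dirsum V W) \<longleftrightarrow> x \<in> carrier V \<and> y \<in> carrier W"
  by (auto simp: dirsum_def)

lemma dirsum_cases:
  assumes "p \<in> carrier (dirsum V W)"
  obtains x y where "p = UPair x y" "x \<in> carrier V" "y \<in> carrier W"
  using assms by (auto simp: dirsum_def)

lemma dirsum_zero: "\<zero>\<^bsub>dirsum V W\<^esub> = UPair \<zero>\<^bsub>V\<^esub> \<zero>\<^bsub>W\<^esub>"
  by (simp add: dirsum_def)

lemma dirsum_add: "UPair x y \<oplus>\<^bsub>dirsum V W\<^esub> UPair x' y' = UPair (x \<oplus>\<^bsub>V\<^esub> x') (y \<oplus>\<^bsub>W\<^esub> y')"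
  by (simp add: dirsum_def)

lemma dirsum_smult: "c \<odot>\<^bsub>dirsum V W\<^esub> UPair x y = UPair (c \<odot>\<^bsub>V\<^esub> x) (c \<odot>\<^bsub>W\<^esub> y)"
  by (simp add: dirsum_def)

lemmas dirsum_simps = carrier_dirsum dirsum_zero dirsum_add dirsum_smult

lemma dirsum_module:
  assumes "Module.module k V" "Module.module k W"
  shows "Module.module k (dirsum V W)"
proof -
  interpret V: Module.module k V by (rule assms)
  interpret W: Module.module k W by (rule assms)
  \<comment> \<open>The existential group axiom gets the componentwise negative as its witness. Zero
    is already written as a pair, the form it takes after \<open>dirsum_simps\<close>.\<close>
  have neg: "\<exists>q\<in>carrier (dirsum V W). q \<oplus>\<^bsub>dirsum V W\<^esub> UPair x y = UPair \<zero>\<^bsub>V\<^esub> \<zero>\<^bsub>W\<^esub>"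
    if "x \<in> carrier V" "y \<in> carrier W" for x y
    using that
    by (intro bexI[of _ "UPair (\<ominus>\<^bsub>V\<^esub> x) (\<ominus>\<^bsub>W\<^esub> y)"])
      (simp_all add: dirsum_simps V.l_neg W.l_neg)
  show ?thesis
  proof (intro Module.module.intro abelian_groupI Module.module_axioms.intro)
    show "cring k" by (rule V.is_cring)
  qed (auto elim!: dirsum_cases intro!: neg simp: dirsum_simps V.a_ac W.a_ac
      V.smult_l_distr W.smult_l_distr V.smult_r_distr W.smult_r_distr
      V.smult_assoc1 W.smult_assoc1)
qed

lemma incl1_eq: "x \<in> carrier V \<Longrightarrow> incl1 V W x = UPair x \<zero>\<^bsub>W\<^esub>"
  by (simp add: incl1_def)

lemma incl2_eq: "y \<in> carrier W \<Longrightarrow> incl2 V W y = UPair \<zero>\<^bsub>V\<^esub> y"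
  by (simp add: incl2_def)

lemma incl1_lin:
  assumes "fd_vectorspace k V" "fd_vectorspace k W"
  shows "incl1 V W \<in> lin_maps k V (dirsum V W)"
  using assms
  by (intro lin_mapsI) (simp_all add: incl1_def fd_simps dirsum_simps)

lemma incl2_lin:
  assumes "fd_vectorspace k V" "fd_vectorspace k W"
  shows "incl2 V W \<in> lin_maps k W (dirsum V W)"
  using assms
  by (intro lin_mapsI) (simp_all add: incl2_def fd_simps dirsum_simps)

text \<open>If \<open>A\<close> generates \<open>V\<close> and \<open>B\<close> generates
  \<open>W\<close>, the images of \<open>A\<close> and \<open>B\<close> under the two inclusions
  together generate the direct sum.\<close>

lemma fd_dirsum:
  assumes V: "fd_vectorspace k V" and W: "fd_vectorspace k W"
  shows "fd_vectorspace k (dirsum V W)"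
proof -
  interpret V: vectorspace k V using V by (simp add: fd_vectorspace_def)
  interpret W: vectorspace k W using W by (simp add: fd_vectorspace_def)
  have vs: "vectorspace k (dirsum V W)"
    using V W by (auto simp: fd_vectorspace_def vectorspace_def intro: dirsum_module)
  interpret D: vectorspace k "dirsum V W" by (rule vs)
  have "V.fin_dim" "W.fin_dim" using V W by (simp_all add: fd_vectorspace_def)
  then obtain A B where A: "finite A" "A \<subseteq> carrier V" "V.span A = carrier V"
    and B: "finite B" "B \<subseteq> carrier W" "W.span B = carrier W"
    by (auto simp: V.fin_dim_def W.fin_dim_def)
  let ?C = "incl1 V W ` A \<union> incl2 V W ` B"
  have C: "?C \<subseteq> carrier (dirsum V W)"
    using A(2) B(2) lin_maps_closed[OF incl1_lin[OF V W]] lin_maps_closed[OF incl2_lin[OF V W]]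
    by blast
  have span: "LinearCombinations.submodule k (D.span ?C) (dirsum V W)"
    by (rule D.span_is_submodule[OF C])
  have own: "?C \<subseteq> D.span ?C"
    by (rule D.in_own_span[OF C])
  \<comment> \<open>The preimage of \<open>D.span ?C\<close> under \<open>incl1\<close> is a
    submodule containing \<open>A\<close>, so it contains the span of \<open>A\<close>, which is all
    of \<open>V\<close>; likewise for \<open>W\<close>.\<close>
  have "V.span A \<subseteq> {x \<in> carrier V. incl1 V W x \<in> D.span ?C}"
    using A(2) own
    by (intro V.span_is_subset submodule_vimage[OF V incl1_lin[OF V W] span])
      (auto simp: incl1_eq dirsum_zero)
  moreover have "W.span B \<subseteq> {y \<in> carrier W. incl2 V W y \<in> D.span ?C}"
    using B(2) own
    by (intro W.span_is_subset submodule_vimage[OF W incl2_lin[OF V W] span])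
      (auto simp: incl2_eq dirsum_zero)
  ultimately have incl: "incl1 V W x \<in> D.span ?C" "incl2 V W y \<in> D.span ?C"
    if "x \<in> carrier V" "y \<in> carrier W" for x y
    using that A(3) B(3) by blast+
  have "carrier (dirsum V W) \<subseteq> D.span ?C"
  proof
    fix p assume "p \<in> carrier (dirsum V W)"
    then obtain x y where p: "p = UPair x y" "x \<in> carrier V" "y \<in> carrier W"
      by (rule dirsum_cases)
    have "incl1 V W x \<oplus>\<^bsub>dirsum V W\<^esub> incl2 V W y \<in> D.span ?C"
      using submodule.m_closed[OF span] incl p by blast
    then show "p \<in> D.span ?C"
      using p by (simp add: incl1_eq incl2_eq dirsum_simps)
  qed
  then have "D.span ?C = carrier (dirsum V W)"
    using D.span_is_subset2[OF C] by blast
  then have "D.fin_dim"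
    unfolding D.fin_dim_def using A(1) B(1) C by (intro exI[of _ ?C]) simp
  then show ?thesis using vs by (simp add: fd_vectorspace_def)
qed

section \<open>Direct sums of maps and maps into direct sums\<close>

lemma dirsum_map_eq:
  "\<lbrakk>x \<in> carrier V; y \<in> carrier W\<rbrakk> \<Longrightarrow> dirsum_map V W f g (UPair x y) = UPair (f x) (g y)"
  by (simp add: dirsum_map_def dirsum_simps)

lemma dirsum_map_lin:
  assumes V: "fd_vectorspace k V1" "fd_vectorspace k V2"
    and f: "f \<in> lin_maps k V1 W1" "g \<in> lin_maps k V2 W2"
  shows "dirsum_map V1 V2 f g \<in> lin_maps k (dirsum V1 V2) (dirsum W1 W2)"
proof (rule lin_mapsI)
  show "dirsum_map V1 V2 f g \<in> extensional (carrier (dirsum V1 V2))"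
    by (simp add: dirsum_map_def)
qed (use assms in \<open>auto elim!: dirsum_cases simp: dirsum_simps dirsum_map_eq fd_simps
    lin_maps_closed lin_maps_add lin_maps_smult\<close>)

lemma dirsum_map_id: "dirsum_map V W (id_map V) (id_map W) = id_map (dirsum V W)"
  by (rule ext) (auto elim!: dirsum_cases simp: dirsum_map_def id_map_def dirsum_simps restrict_def)

lemma dirsum_map_compose:
  assumes "f1 \<in> lin_maps k U1 V1" "f2 \<in> lin_maps k U2 V2"
  shows "dirsum_map U1 U2 (compose (carrier U1) g1 f1) (compose (carrier U2) g2 f2)
    = compose (carrier (dirsum U1 U2)) (dirsum_map V1 V2 g1 g2) (dirsum_map U1 U2 f1 f2)"
proof (rule extensionalityI)
  show "dirsum_map U1 U2 (compose (carrier U1) g1 f1) (compose (carrier U2) g2 f2)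
      \<in> extensional (carrier (dirsum U1 U2))"
    by (simp add: dirsum_map_def)
qed (use assms in \<open>auto elim!: dirsum_cases
    simp: compose_eq dirsum_simps dirsum_map_eq lin_maps_closed\<close>)

text \<open>\<open>pair_map V f g\<close> is what the functors write as \<open>\<iota>\<^sub>1f + \<iota>\<^sub>2g\<close>.\<close>

definition pair_map ::
  "('a, 'v univ) module \<Rightarrow> ('v univ \<Rightarrow> 'v univ) \<Rightarrow> ('v univ \<Rightarrow> 'v univ) \<Rightarrow> 'v univ \<Rightarrow> 'v univ" where
  "pair_map V f g = (\<lambda>x\<in>carrier V. UPair (f x) (g x))"

lemma pair_map_eq: "x \<in> carrier V \<Longrightarrow> pair_map V f g x = UPair (f x) (g x)"
  by (simp add: pair_map_def)

lemma pair_map_lin: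
  assumes "fd_vectorspace k V" "f \<in> lin_maps k V V1" "g \<in> lin_maps k V V2"
  shows "pair_map V f g \<in> lin_maps k V (dirsum V1 V2)"
  using assms
  by (intro lin_mapsI)
    (simp_all add: pair_map_def dirsum_simps fd_simps lin_maps_closed lin_maps_add lin_maps_smult)

text \<open>The summands are \<open>UPair (f x) \<zero>\<close> and
  \<open>UPair \<zero> (g x)\<close>, and the zero laws merge them. This brings the third and fourth
  arrows of the functors into a normal form whose components can be read off.\<close>

lemma add_map_incl:
  assumes "fd_vectorspace k V1" "fd_vectorspace k V2"
    and "f \<in> lin_maps k V V1" "g \<in> lin_maps k V V2"
  shows "add_map V (dirsum V1 V2) (compose (carrier V) (incl1 V1 V2) f)
    (compose (carrier V) (incl2 V1 V2) g) = pair_map V f g"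
  using assms
  by (auto simp: fun_eq_iff add_map_def pair_map_def compose_eq incl1_eq incl2_eq dirsum_add
      lin_maps_closed fd_simps restrict_def)

text \<open>An inclusion standing alone in a sum is treated as its composite with an identity; the
  next two lemmas do the same for the other positions.\<close>

lemma add_map_incl_id1:
  assumes "fd_vectorspace k V1" "fd_vectorspace k V2" "g \<in> lin_maps k V1 V2"
  shows "add_map V1 (dirsum V1 V2) (incl1 V1 V2) (compose (carrier V1) (incl2 V1 V2) g)
    = pair_map V1 (id_map V1) g"
  using assms add_map_incl[of k V1 V2 "id_map V1" V1 g]
  by (simp add: compose_id_right[OF incl1_lin] id_map_lin)

lemma add_map_incl_id2:
  assumes "fd_vectorspace k V1" "fd_vectorspace k V2" "f \<in> lin_maps k V2 V1"
  shows "add_map V2 (dirsum V1 V2) (compose (carrier V2) (incl1 V1 V2) f) (incl2 V1 V2)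
    = pair_map V2 f (id_map V2)"
  using assms add_map_incl[of k V1 V2 f V2 "id_map V2"]
  by (simp add: compose_id_right[OF incl2_lin] id_map_lin)

lemma add_map_incl_id:
  assumes "fd_vectorspace k V"
  shows "add_map V (dirsum V V) (incl1 V V) (incl2 V V) = pair_map V (id_map V) (id_map V)"
  using assms add_map_incl_id2[of k V V "id_map V"]
  by (simp add: compose_id_right[OF incl1_lin] id_map_lin)

text \<open>\<open>UPair\<close> is injective, so an equation in the direct sum amounts to its two
  component equations. This is how one square over the direct sum becomes two squares over the
  summands.\<close>

lemma dirsum_map_pair:
  assumes "a \<in> lin_maps k V V1" "b \<in> lin_maps k V V2" "l \<in> lin_maps k V W" "x \<in> carrier V"
  shows "dirsum_map V1 V2 l1 l2 (pair_map V a b x) = pair_map W a' b' (l x)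
    \<longleftrightarrow> l1 (a x) = a' (l x) \<and> l2 (b x) = b' (l x)"
  using assms by (simp add: pair_map_eq dirsum_map_eq lin_maps_closed)

section \<open>Subspaces\<close>

lemma carrier_subsp: "carrier (subsp V R) = R"
  by (simp add: subsp_def)

lemma subspace_carrier: "\<lbrakk>VectorSpace.subspace k R V; p \<in> R\<rbrakk> \<Longrightarrow> p \<in> carrier V"
  by (auto simp: VectorSpace.subspace_def LinearCombinations.submodule_def)

lemma subspace_dirsumD:
  assumes "VectorSpace.subspace k R (dirsum V W)" "UPair x y \<in> R"
  shows "x \<in> carrier V" "y \<in> carrier W"
  using subspace_carrier[OF assms] by (simp_all add: carrier_dirsum)

text \<open>\<open>id_map\<close> fixes only elements of the carrier, but all related elements lie
  there because \<open>R\<close> is a subspace of the direct sum.\<close>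

lemma subspace_id_map:
  assumes "VectorSpace.subspace k R (dirsum V W)" "UPair x y \<in> R"
  shows "UPair (id_map V x) (id_map W y) \<in> R"
  using subspace_dirsumD[OF assms] assms(2) by (simp add: id_map_eq)

lemma restrict_lin:
  assumes "VectorSpace.subspace k R V" "f \<in> lin_maps k V W" "\<And>p. p \<in> R \<Longrightarrow> f p \<in> S"
  shows "restrict f R \<in> lin_maps k (subsp V R) (subsp W S)"
proof -
  interpret LinearCombinations.submodule k R V
    using assms(1) by (simp add: VectorSpace.subspace_def)
  show ?thesis
    using assms
    by (intro lin_mapsI)
      (simp_all add: subsp_def subspace_carrier[OF assms(1)] lin_maps_add lin_maps_smult)
qed

lemma subsp_incl_lin:
  assumes "VectorSpace.subspace k R V"
  shows "id_map (subsp V R) \<in> lin_maps k (subsp V R) V"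
proof -
  interpret LinearCombinations.submodule k R V
    using assms by (simp add: VectorSpace.subspace_def)
  show ?thesis
    by (intro lin_mapsI)
      (simp_all add: subsp_def id_map_def subspace_carrier[OF assms])
qed

text \<open>Both vertical arrows are inclusions, so the square makes \<open>l\<close> agree with
  \<open>dirsum_map V1 V2 l1 l2\<close> on \<open>R\<close>. Then \<open>l\<close> is determined,
  and its landing in \<open>S\<close> is exactly preservation of the relation. The left side is
  grouped as in \<open>Hom_sum_rep\<close> below, so that the equivalence can rewrite there.\<close>

lemma dirsum_map_subsp:
  assumes R: "VectorSpace.subspace k R (dirsum V1 V2)"
    and l1: "l1 \<in> lin_maps k V1 W1" and l2: "l2 \<in> lin_maps k V2 W2"
    and fd: "fd_vectorspace k V1" "fd_vectorspace k V2"
  shows "l \<in> lin_maps k (subsp (dirsum V1 V2) R) (subsp (dirsum W1 W2) S) \<and>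
      (\<forall>p\<in>R. dirsum_map V1 V2 l1 l2 (id_map (subsp (dirsum V1 V2) R) p)
        = id_map (subsp (dirsum W1 W2) S) (l p))
    \<longleftrightarrow> (\<forall>x y. UPair x y \<in> R \<longrightarrow> UPair (l1 x) (l2 y) \<in> S)
      \<and> l = restrict (dirsum_map V1 V2 l1 l2) R"
    (is "?lhs \<longleftrightarrow> ?rhs")
proof
  assume ?lhs
  then have l: "l \<in> lin_maps k (subsp (dirsum V1 V2) R) (subsp (dirsum W1 W2) S)"
    by simp
  \<comment> \<open>The outer \<open>id_map\<close> acts as the identity only on \<open>S\<close>;
    linearity of \<open>l\<close> into the subspace puts \<open>l p\<close> there, and the square
    collapses to an equation.\<close>
  have eq: "dirsum_map V1 V2 l1 l2 p = l p" and S: "l p \<in> S" if "p \<in> R" for p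
    using \<open>?lhs\<close> that lin_maps_closed[of l k "subsp (dirsum V1 V2) R" "subsp (dirsum W1 W2) S"]
    by (auto simp: id_map_eq carrier_subsp)
  have "UPair (l1 x) (l2 y) \<in> S" if "UPair x y \<in> R" for x y
    using S[OF that] eq[OF that] subspace_carrier[OF R that]
    by (simp add: carrier_dirsum dirsum_map_eq)
  moreover have "l = restrict (dirsum_map V1 V2 l1 l2) R"
    using eq lin_maps_extensional[OF l]
    by (intro extensionalityI[of _ R]) (auto simp: carrier_subsp)
  ultimately show ?rhs by blast
next
  assume rhs: ?rhs
  have S: "dirsum_map V1 V2 l1 l2 p \<in> S" if "p \<in> R" for p
    using subspace_carrier[OF R that] that rhs
    by (auto elim!: dirsum_cases simp: dirsum_map_eq)
  then have "restrict (dirsum_map V1 V2 l1 l2) R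
      \<in> lin_maps k (subsp (dirsum V1 V2) R) (subsp (dirsum W1 W2) S)"
    by (intro restrict_lin[OF R dirsum_map_lin[OF fd l1 l2]])
  then show ?lhs
    using rhs S by (auto simp: id_map_eq carrier_subsp)
qed

section \<open>The categories\<close>

lemma rep_simps:
  "V \<in> Obj (rep Q k) \<longleftrightarrow> space V \<in> verts Q \<rightarrow>\<^sub>E {M. fd_vectorspace k M} \<and>
    arrow_map V \<in> (\<Pi>\<^sub>E a\<in>arcs Q. lin_maps k (space V (tail Q a)) (space V (head Q a)))"
  "l \<in> Hom (rep Q k) V W \<longleftrightarrow> l \<in> (\<Pi>\<^sub>E i\<in>verts Q. lin_maps k (space V i) (space W i)) \<and>
    (\<forall>a\<in>arcs Q. \<forall>x\<in>carrier (space V (tail Q a)).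
      l (head Q a) (arrow_map V a x) = arrow_map W a (l (tail Q a) x))"
  "Ident (rep Q k) V = (\<lambda>i\<in>verts Q. id_map (space V i))"
  "Comp (rep Q k) U V W g f = (\<lambda>i\<in>verts Q. compose (carrier (space U i)) (g i) (f i))"
  by (simp_all add: rep_def)

lemma category_rep:
  assumes "wf_digraph Q"
  shows "category (rep Q k)"
proof -
  \<comment> \<open>Both ends of every arc are vertices, so the components of a morphism at these
    ends are linear maps.\<close>
  interpret wf_digraph Q by (rule assms)
  have fd: "fd_vectorspace k (space V i)" if "V \<in> Obj (rep Q k)" "i \<in> verts Q" for V i
    using that by (auto simp: rep_simps)
  have arrow: "arrow_map V a x \<in> carrier (space V (head Q a))"
    if "V \<in> Obj (rep Q k)" "a \<in> arcs Q" "x \<in> carrier (space V (tail Q a))" for V a x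
    using that by (auto simp: rep_simps intro: lin_maps_closed)
  have lin: "f i \<in> lin_maps k (space V i) (space W i)"
    if "f \<in> Hom (rep Q k) V W" "i \<in> verts Q" for f V W i
    using that by (auto simp: rep_simps)
  have nat: "f (head Q a) (arrow_map V a x) = arrow_map W a (f (tail Q a) x)"
    if "f \<in> Hom (rep Q k) V W" "a \<in> arcs Q" "x \<in> carrier (space V (tail Q a))" for f V W a x
    using that by (auto simp: rep_simps)
  \<comment> \<open>Morphisms are undefined off the vertices, so the unit laws need checking only at
    vertices.\<close>
  have ext: "f \<in> extensional (verts Q)" if "f \<in> Hom (rep Q k) V W" for f V W
    using that by (simp add: rep_simps(2) PiE_iff)
  show ?thesis
  proof
    fix A assume A: "A \<in> Obj (rep Q k)"
    then show "Ident (rep Q k) A \<in> Hom (rep Q k) A A"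
      by (simp add: rep_simps(2,3) id_map_lin fd id_map_eq arrow)
  next
    fix A B D f g
    assume A: "A \<in> Obj (rep Q k)" and f: "f \<in> Hom (rep Q k) A B" and g: "g \<in> Hom (rep Q k) B D"
    \<comment> \<open>The square of \<open>g\<close> is available only at points of the space of
      \<open>B\<close>; this places the image of \<open>x\<close> there so that the two squares can
      be pasted.\<close>
    have "f (tail Q a) x \<in> carrier (space B (tail Q a))"
      if "a \<in> arcs Q" "x \<in> carrier (space A (tail Q a))" for a x
      using lin_maps_closed[OF lin[OF f]] that by simp
    then show "Comp (rep Q k) A B D g f \<in> Hom (rep Q k) A D"
      using fd_compose[OF fd[OF A] lin[OF f] lin[OF g]]
      by (simp add: rep_simps(2,4) compose_eq arrow A nat[OF f] nat[OF g])
  next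
    fix A B f
    assume f: "f \<in> Hom (rep Q k) A B"
    show "Comp (rep Q k) A B B (Ident (rep Q k) B) f = f"
      by (rule extensionalityI[OF _ ext[OF f]])
        (simp_all add: rep_simps(3,4) compose_id_left[OF lin[OF f]])
    show "Comp (rep Q k) A A B f (Ident (rep Q k) A) = f"
      by (rule extensionalityI[OF _ ext[OF f]])
        (simp_all add: rep_simps(3,4) compose_id_right[OF lin[OF f]])
  next
    fix A B D E f g h
    assume f: "f \<in> Hom (rep Q k) A B"
    show "Comp (rep Q k) A D E h (Comp (rep Q k) A B D g f)
        = Comp (rep Q k) A B E (Comp (rep Q k) B D E h g) f"
      by (simp add: rep_simps(4) fun_eq_iff restrict_def lin_compose_assoc[OF lin[OF f]])
  qed
qed

text \<open>Related pairs lie in the carriers, where \<open>compose\<close> and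
  \<open>id_map\<close> take their intended values; so the relation condition passes to composites
  and identities although it quantifies over all \<open>x\<close> and \<open>y\<close>.\<close>

lemma category_lrel: "category (lrel k)"
proof
  fix A assume "A \<in> Obj (lrel k)"
  then show "Ident (lrel k) A \<in> Hom (lrel k) A A"
    by (cases A) (auto simp: lrel_def id_map_lin intro: subspace_id_map)
next
  fix A B D f g
  assume "A \<in> Obj (lrel k)" "f \<in> Hom (lrel k) A B" "g \<in> Hom (lrel k) B D"
  then show "Comp (lrel k) A B D g f \<in> Hom (lrel k) A D"
    by (cases A; cases B; cases D)
      (auto simp: lrel_def fd_compose compose_eq carrier_dirsum dest: subspace_carrier)
next
  fix A B f
  assume f: "f \<in> Hom (lrel k) A B"
  show "Comp (lrel k) A B B (Ident (lrel k) B) f = f"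
    using f by (cases A; cases B) (auto simp: lrel_def intro: compose_id_left)
  show "Comp (lrel k) A A B f (Ident (lrel k) A) = f"
    using f by (cases A; cases B) (auto simp: lrel_def intro: compose_id_right)
next
  fix A B D E f g h
  assume "f \<in> Hom (lrel k) A B"
  then show "Comp (lrel k) A D E h (Comp (lrel k) A B D g f)
      = Comp (lrel k) A B E (Comp (lrel k) B D E h g) f"
    by (cases A; cases B; cases D; cases E) (auto simp: lrel_def intro: lin_compose_assoc)
qed

lemma category_lrel22: "category (lrel22 k)"
proof
  fix A assume "A \<in> Obj (lrel22 k)"
  then show "Ident (lrel22 k) A \<in> Hom (lrel22 k) A A"
    by (cases A)
      (auto simp: lrel22_def id_map_lin intro: subspace_id_map)
next
  fix A B D f g
  assume "A \<in> Obj (lrel22 k)" "f \<in> Hom (lrel22 k) A B" "g \<in> Hom (lrel22 k) B D"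
  then show "Comp (lrel22 k) A B D g f \<in> Hom (lrel22 k) A D"
    by (cases A; cases B; cases D; cases f; cases g)
      (auto simp: lrel22_def fd_compose compose_eq carrier_dirsum dest: subspace_carrier)
next
  fix A B f
  assume f: "f \<in> Hom (lrel22 k) A B"
  show "Comp (lrel22 k) A B B (Ident (lrel22 k) B) f = f"
    using f by (cases A; cases B; cases f) (auto simp: lrel22_def intro: compose_id_left)
  show "Comp (lrel22 k) A A B f (Ident (lrel22 k) A) = f"
    using f by (cases A; cases B; cases f) (auto simp: lrel22_def intro: compose_id_right)
next
  fix A B D E f g h
  assume "f \<in> Hom (lrel22 k) A B"
  then show "Comp (lrel22 k) A D E h (Comp (lrel22 k) A B D g f)
      = Comp (lrel22 k) A B E (Comp (lrel22 k) B D E h g) f"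
    by (cases A; cases B; cases D; cases E; cases f; cases g; cases h)
      (auto simp: lrel22_def intro: lin_compose_assoc)
qed

lemma wf_quivers:
  "wf_digraph quiver_F" "wf_digraph quiver_S" "wf_digraph quiver_D"
  "wf_digraph quiver_K" "wf_digraph quiver_C"
  by (unfold_locales;
      auto simp: quiver_F_def quiver_S_def quiver_D_def quiver_K_def quiver_C_def)+

text \<open>Equality of the image with the whole target Hom-set yields fullness and, at once, that
  morphisms are sent to morphisms. One computation of a Hom-set thus serves both purposes.\<close>

lemma fully_faithful_functorI:
  assumes "category C" "category D"
    and "\<And>A. A \<in> Obj C \<Longrightarrow> on_obj F A \<in> Obj D"
    and "\<And>A. A \<in> Obj C \<Longrightarrow> on_mor F A A (Ident C A) = Ident D (on_obj F A)"
    and "\<And>A B E f g. \<lbrakk>A \<in> Obj C; B \<in> Obj C; E \<in> Obj C; f \<in> Hom C A B; g \<in> Hom C B E\<rbrakk>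
      \<Longrightarrow> on_mor F A E (Comp C A B E g f)
        = Comp D (on_obj F A) (on_obj F B) (on_obj F E) (on_mor F B E g) (on_mor F A B f)"
    and "\<And>A B. \<lbrakk>A \<in> Obj C; B \<in> Obj C\<rbrakk> \<Longrightarrow> inj_on (on_mor F A B) (Hom C A B)"
    and "\<And>A B. \<lbrakk>A \<in> Obj C; B \<in> Obj C\<rbrakk>
      \<Longrightarrow> on_mor F A B ` Hom C A B = Hom D (on_obj F A) (on_obj F B)"
  shows "fully_faithful_functor C D F"
proof -
  interpret C: category C by (rule assms)
  interpret D: category D by (rule assms)
  show ?thesis
  proof
    fix A B f assume "A \<in> Obj C" "B \<in> Obj C" "f \<in> Hom C A B"
    then show "on_mor F A B f \<in> Hom D (on_obj F A) (on_obj F B)"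
      using assms(7) by blast
  qed (simp_all add: assms bij_betw_def)
qed

section \<open>Representations with top space a direct sum\<close>

lemma mk_mor_F_simps [simp]:
  "mk_mor_F l0 l1 l2 l3 l4 0 = l0" "mk_mor_F l0 l1 l2 l3 l4 1 = l1"
  "mk_mor_F l0 l1 l2 l3 l4 2 = l2" "mk_mor_F l0 l1 l2 l3 l4 3 = l3"
  "mk_mor_F l0 l1 l2 l3 l4 4 = l4"
  by (simp_all add: mk_mor_F_def)

lemma mk_mor_F_eqI:
  assumes "f \<in> extensional {0, 1, 2, 3, 4}"
    and "f 0 = l0" "f 1 = l1" "f 2 = l2" "f 3 = l3" "f 4 = l4"
  shows "f = mk_mor_F l0 l1 l2 l3 l4"
  using assms by (auto simp: mk_mor_F_def fun_eq_iff extensional_def)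

lemma mk_mor_F_extensional: "mk_mor_F l0 l1 l2 l3 l4 \<in> extensional {0, 1, 2, 3, 4}"
  by (simp add: mk_mor_F_def extensional_def)

text \<open>The common shape of the values of all six functors, which differ only in the spaces and
  in the last two arrows \<open>g\<close> and \<open>h\<close>.\<close>

definition sum_rep ::
  "('a, 'v univ) module \<Rightarrow> ('a, 'v univ) module \<Rightarrow> ('a, 'v univ) module \<Rightarrow> ('a, 'v univ) module
    \<Rightarrow> ('v univ \<Rightarrow> 'v univ) \<Rightarrow> ('v univ \<Rightarrow> 'v univ) \<Rightarrow> ('a, 'v) nat_rep" where
  "sum_rep V1 V2 V3 V4 g h = mk_rep_F (dirsum V1 V2) V1 V2 V3 V4 (incl1 V1 V2) (incl2 V1 V2) g h"

text \<open>\<open>V1\<close> and \<open>V2\<close> are the source spaces: they fix where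
  \<open>dirsum_map\<close> is defined, and the target does not enter its formula.\<close>

definition sum_mor ::
  "('a, 'v univ) module \<Rightarrow> ('a, 'v univ) module \<Rightarrow> ('v univ \<Rightarrow> 'v univ) \<Rightarrow> ('v univ \<Rightarrow> 'v univ)
    \<Rightarrow> ('v univ \<Rightarrow> 'v univ) \<Rightarrow> ('v univ \<Rightarrow> 'v univ) \<Rightarrow> 'v nat_mor" where
  "sum_mor V1 V2 l1 l2 l3 l4 = mk_mor_F (dirsum_map V1 V2 l1 l2) l1 l2 l3 l4"

text \<open>The components at the vertices 1 to 4 can be read off, and the one at 0 is built from
  those at 1 and 2. Faithfulness of every functor rests on this.\<close>

lemma sum_mor_eq_iff:
  "sum_mor V1 V2 l1 l2 l3 l4 = sum_mor V1 V2 m1 m2 m3 m4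
    \<longleftrightarrow> l1 = m1 \<and> l2 = m2 \<and> l3 = m3 \<and> l4 = m4"
  unfolding sum_mor_def by (metis mk_mor_F_simps)

lemma space_sum_rep:
  "space (sum_rep V1 V2 V3 V4 g h) 0 = dirsum V1 V2"
  "space (sum_rep V1 V2 V3 V4 g h) 1 = V1" "space (sum_rep V1 V2 V3 V4 g h) 2 = V2"
  "space (sum_rep V1 V2 V3 V4 g h) 3 = V3" "space (sum_rep V1 V2 V3 V4 g h) 4 = V4"
  by (simp_all add: sum_rep_def mk_rep_F_def)

lemma arrow_map_sum_rep:
  "arrow_map (sum_rep V1 V2 V3 V4 g h) \<alpha> = incl1 V1 V2"
  "arrow_map (sum_rep V1 V2 V3 V4 g h) \<beta> = incl2 V1 V2"
  "arrow_map (sum_rep V1 V2 V3 V4 g h) \<gamma> = g"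
  "arrow_map (sum_rep V1 V2 V3 V4 g h) \<delta> = h"
  by (simp_all add: sum_rep_def mk_rep_F_def)

lemma sum_rep_in_Obj:
  assumes fd: "fd_vectorspace k V1" "fd_vectorspace k V2" "fd_vectorspace k V3" "fd_vectorspace k V4"
    and gh: "g \<in> lin_maps k V3 (dirsum V1 V2)" "h \<in> lin_maps k V4 (dirsum V1 V2)"
  shows "sum_rep V1 V2 V3 V4 g h \<in> Obj (rep quiver_F k)"
proof -
  have "space (sum_rep V1 V2 V3 V4 g h) \<in> extensional {0, 1, 2, 3, 4}"
    by (auto simp: sum_rep_def mk_rep_F_def extensional_def)
  moreover have "arrow_map (sum_rep V1 V2 V3 V4 g h) \<in> extensional {\<alpha>, \<beta>, \<gamma>, \<delta>}"
    by (auto simp: sum_rep_def mk_rep_F_def extensional_def)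
  ultimately show ?thesis
    using assms
    by (simp add: rep_simps(1) quiver_F_def PiE_iff space_sum_rep arrow_map_sum_rep
        fd_dirsum incl1_lin incl2_lin)
qed

lemma Ident_sum_rep:
  "Ident (rep quiver_F k) (sum_rep V1 V2 V3 V4 g h)
    = sum_mor V1 V2 (id_map V1) (id_map V2) (id_map V3) (id_map V4)"
  unfolding sum_mor_def dirsum_map_id
  by (rule mk_mor_F_eqI) (simp_all add: rep_simps(3) quiver_F_def space_sum_rep)

text \<open>At vertex 0 this is functoriality of the direct sum. Composition in \<open>rep\<close>
  restricts to the spaces of the first object, so \<open>B\<close> and \<open>E\<close> may be
  arbitrary.\<close>

lemma Comp_sum_mor:
  assumes "f1 \<in> lin_maps k U1 V1" "f2 \<in> lin_maps k U2 V2"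
  shows "Comp (rep quiver_F k) (sum_rep U1 U2 U3 U4 g h) B E
      (sum_mor V1 V2 g1 g2 g3 g4) (sum_mor U1 U2 f1 f2 f3 f4)
    = sum_mor U1 U2 (compose (carrier U1) g1 f1) (compose (carrier U2) g2 f2)
        (compose (carrier U3) g3 f3) (compose (carrier U4) g4 f4)"
  unfolding sum_mor_def dirsum_map_compose[OF assms]
  by (rule mk_mor_F_eqI) (simp_all add: rep_simps(4) quiver_F_def space_sum_rep)

text \<open>Commutation with the inclusions of \<open>V1\<close> and \<open>V2\<close> determines the component at the vertex
  \<open>0\<close> of a morphism.\<close>

lemma Hom_sum_rep:
  assumes V: "fd_vectorspace k V1" "fd_vectorspace k V2"
    and W: "fd_vectorspace k W1" "fd_vectorspace k W2"
  shows "Hom (rep quiver_F k) (sum_rep V1 V2 V3 V4 g h) (sum_rep W1 W2 W3 W4 g' h') =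
    {sum_mor V1 V2 l1 l2 l3 l4 | l1 l2 l3 l4.
      l1 \<in> lin_maps k V1 W1 \<and> l2 \<in> lin_maps k V2 W2 \<and>
      (l3 \<in> lin_maps k V3 W3 \<and>
        (\<forall>x\<in>carrier V3. dirsum_map V1 V2 l1 l2 (g x) = g' (l3 x))) \<and>
      (l4 \<in> lin_maps k V4 W4 \<and>
        (\<forall>x\<in>carrier V4. dirsum_map V1 V2 l1 l2 (h x) = h' (l4 x)))}"
    (is "?L = ?R")
proof
  show "?L \<subseteq> ?R"
  proof
    fix l assume "l \<in> ?L"
    then have ext: "l \<in> extensional {0, 1, 2, 3, 4}"
      and lin: "l 0 \<in> lin_maps k (dirsum V1 V2) (dirsum W1 W2)" "l 1 \<in> lin_maps k V1 W1"
        "l 2 \<in> lin_maps k V2 W2" "l 3 \<in> lin_maps k V3 W3" "l 4 \<in> lin_maps k V4 W4"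
      and incl: "\<forall>x\<in>carrier V1. l 0 (incl1 V1 V2 x) = incl1 W1 W2 (l 1 x)"
        "\<forall>x\<in>carrier V2. l 0 (incl2 V1 V2 x) = incl2 W1 W2 (l 2 x)"
      and gh: "\<forall>x\<in>carrier V3. l 0 (g x) = g' (l 3 x)" "\<forall>x\<in>carrier V4. l 0 (h x) = h' (l 4 x)"
      by (simp_all add: rep_simps(2) quiver_F_def PiE_iff space_sum_rep arrow_map_sum_rep)
    have l0: "l 0 = dirsum_map V1 V2 (l 1) (l 2)"
    proof (rule lin_maps_eqI[OF lin(1) dirsum_map_lin[OF V lin(2,3)]])
      fix p assume "p \<in> carrier (dirsum V1 V2)"
      then obtain x y where p: "p = UPair x y" "x \<in> carrier V1" "y \<in> carrier V2"
        by (rule dirsum_cases)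
      have l: "l 1 x \<in> carrier W1" "l 2 y \<in> carrier W2"
        using lin p by (simp_all add: lin_maps_closed)
      \<comment> \<open>Every element is a sum of one from each inclusion, so additivity and the
        first two squares fix \<open>l 0\<close>.\<close>
      have "p = incl1 V1 V2 x \<oplus>\<^bsub>dirsum V1 V2\<^esub> incl2 V1 V2 y"
        using p V by (simp add: incl1_eq incl2_eq dirsum_add fd_simps)
      then have "l 0 p = l 0 (incl1 V1 V2 x) \<oplus>\<^bsub>dirsum W1 W2\<^esub> l 0 (incl2 V1 V2 y)"
        using p V by (simp add: lin_maps_add[OF lin(1)] incl1_eq incl2_eq carrier_dirsum fd_simps)
      also have "\<dots> = dirsum_map V1 V2 (l 1) (l 2) p"
        using p W incl l by (simp add: incl1_eq[of "l 1 x"] incl2_eq[of "l 2 y"] dirsum_add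
            dirsum_map_eq fd_simps)
      finally show "l 0 p = dirsum_map V1 V2 (l 1) (l 2) p" .
    qed
    have "l = sum_mor V1 V2 (l 1) (l 2) (l 3) (l 4)"
      unfolding sum_mor_def using ext l0 by (intro mk_mor_F_eqI) simp_all
    then show "l \<in> ?R"
      using lin gh l0 by auto
  qed
  \<comment> \<open>Conversely, \<open>dirsum_map\<close> commutes with the inclusions because
    \<open>l1\<close> and \<open>l2\<close> send zero to zero.\<close>
  show "?R \<subseteq> ?L"
    using assms
    by (auto simp: rep_simps(2) quiver_F_def PiE_iff space_sum_rep arrow_map_sum_rep sum_mor_def
        mk_mor_F_extensional dirsum_map_lin incl1_eq incl2_eq dirsum_map_eq fd_simps
        lin_maps_closed lin_maps_zero[OF V(1) W(1)] lin_maps_zero[OF V(2) W(2)])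
qed

text \<open>The pointwise splitting of \<open>dirsum_map_pair\<close>, grouped as in
  \<open>Hom_sum_rep\<close>. Linearity of \<open>l\<close> stays on both sides:
  \<open>pair_map W a' b'\<close> is a pair only at points of \<open>W\<close>, and linearity puts
  \<open>l x\<close> there.\<close>

lemma pair_map_commute_iff:
  assumes "a \<in> lin_maps k V V1" "b \<in> lin_maps k V V2"
  shows "l \<in> lin_maps k V W \<and>
      (\<forall>x\<in>carrier V. dirsum_map V1 V2 l1 l2 (pair_map V a b x) = pair_map W a' b' (l x))
    \<longleftrightarrow> l \<in> lin_maps k V W \<and> (\<forall>x\<in>carrier V. l1 (a x) = a' (l x))
      \<and> (\<forall>x\<in>carrier V. l2 (b x) = b' (l x))"
  using assms by (auto simp: dirsum_map_pair)

text \<open>With identities as first components, the first square reads \<open>l1 x = l x\<close>,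
  so \<open>l\<close> and \<open>l1\<close> coincide by extensionality, and only the square of
  \<open>b\<close> remains. The next lemma is the mirror image.\<close>

lemma pair_map_id1_commute_iff:
  assumes fd: "fd_vectorspace k V1" and b: "b \<in> lin_maps k V1 V2" and l1: "l1 \<in> lin_maps k V1 W1"
  shows "l \<in> lin_maps k V1 W1 \<and>
      (\<forall>x\<in>carrier V1. dirsum_map V1 V2 l1 l2 (pair_map V1 (id_map V1) b x)
        = pair_map W1 (id_map W1) b' (l x))
    \<longleftrightarrow> l = l1 \<and> (\<forall>x\<in>carrier V1. l2 (b x) = b' (l1 x))"
  unfolding pair_map_commute_iff[OF id_map_lin[OF fd] b]
  using l1 by (auto simp: id_map_eq lin_maps_closed intro: lin_maps_eqI)

lemma pair_map_id2_commute_iff: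
  assumes fd: "fd_vectorspace k V2" and a: "a \<in> lin_maps k V2 V1" and l2: "l2 \<in> lin_maps k V2 W2"
  shows "l \<in> lin_maps k V2 W2 \<and>
      (\<forall>x\<in>carrier V2. dirsum_map V1 V2 l1 l2 (pair_map V2 a (id_map V2) x)
        = pair_map W2 a' (id_map W2) (l x))
    \<longleftrightarrow> l = l2 \<and> (\<forall>x\<in>carrier V2. l1 (a x) = a' (l2 x))"
  unfolding pair_map_commute_iff[OF a id_map_lin[OF fd]]
  using l2 by (auto simp: id_map_eq lin_maps_closed intro: lin_maps_eqI)

section \<open>Functors on representations\<close>

text \<open>A criterion covering the four functors on quiver representations. The vertices
  \<open>i\<close> and \<open>j\<close> of \<open>Q\<close> supply the spaces at 3 and 4 and may
  repeat 1 or 2. Fullness is concentrated in \<open>hom\<close>: the component families allowed by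
  \<open>Hom_sum_rep\<close> are exactly those of morphisms over \<open>Q\<close>.\<close>

lemma fully_faithful_functor_sum_rep:
  fixes k :: "('a, 'c) ring_scheme" and Q :: "(nat, arrow) pre_digraph"
    and F :: "(('a, 'v) nat_rep, 'v nat_mor, ('a, 'v) nat_rep, 'v nat_mor) fun_data"
  assumes wf: "wf_digraph Q" and verts: "verts Q = {1, 2, i, j}"
    and obj: "\<And>V. V \<in> Obj (rep Q k) \<Longrightarrow> on_obj F V =
      sum_rep (space V 1) (space V 2) (space V i) (space V j) (g V) (h V)"
    and mor: "\<And>V W l. on_mor F V W l = sum_mor (space V 1) (space V 2) (l 1) (l 2) (l i) (l j)"
    and g: "\<And>V. V \<in> Obj (rep Q k)
      \<Longrightarrow> g V \<in> lin_maps k (space V i) (dirsum (space V 1) (space V 2))"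
    and h: "\<And>V. V \<in> Obj (rep Q k)
      \<Longrightarrow> h V \<in> lin_maps k (space V j) (dirsum (space V 1) (space V 2))"
    and hom: "\<And>V W l1 l2 l3 l4. \<lbrakk>V \<in> Obj (rep Q k); W \<in> Obj (rep Q k)\<rbrakk> \<Longrightarrow>
      l1 \<in> lin_maps k (space V 1) (space W 1) \<and> l2 \<in> lin_maps k (space V 2) (space W 2) \<and>
      (l3 \<in> lin_maps k (space V i) (space W i) \<and> (\<forall>x\<in>carrier (space V i).
        dirsum_map (space V 1) (space V 2) l1 l2 (g V x) = g W (l3 x))) \<and>
      (l4 \<in> lin_maps k (space V j) (space W j) \<and> (\<forall>x\<in>carrier (space V j).
        dirsum_map (space V 1) (space V 2) l1 l2 (h V x) = h W (l4 x)))
      \<longleftrightarrow> (\<exists>l\<in>Hom (rep Q k) V W. l 1 = l1 \<and> l 2 = l2 \<and> l i = l3 \<and> l j = l4)"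
  shows "fully_faithful_functor (rep Q k) (rep quiver_F k) F"
proof (rule fully_faithful_functorI)
  fix V :: "('a, 'v) nat_rep"
  assume V: "V \<in> Obj (rep Q k)"
  then have "fd_vectorspace k (space V n)" if "n \<in> {1, 2, i, j}" for n
    using that by (auto simp: rep_simps(1) verts)
  then show "on_obj F V \<in> Obj (rep quiver_F k)"
    unfolding obj[OF V] by (intro sum_rep_in_Obj g[OF V] h[OF V]) simp_all
  show "on_mor F V V (Ident (rep Q k) V) = Ident (rep quiver_F k) (on_obj F V)"
    unfolding obj[OF V] mor Ident_sum_rep by (simp add: rep_simps(3) verts)
next
  fix U V W :: "('a, 'v) nat_rep" and f g
  assume U: "U \<in> Obj (rep Q k)" and f: "f \<in> Hom (rep Q k) U V"
  have "f 1 \<in> lin_maps k (space U 1) (space V 1)" "f 2 \<in> lin_maps k (space U 2) (space V 2)"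
    using f by (auto simp: rep_simps(2) verts)
  then show "on_mor F U W (Comp (rep Q k) U V W g f)
      = Comp (rep quiver_F k) (on_obj F U) (on_obj F V) (on_obj F W)
          (on_mor F V W g) (on_mor F U V f)"
    unfolding obj[OF U] mor by (subst Comp_sum_mor) (simp_all add: rep_simps(4) verts)
next
  fix V W :: "('a, 'v) nat_rep"
  show "inj_on (on_mor F V W) (Hom (rep Q k) V W)"
    \<comment> \<open>The components at 1, 2, \<open>i\<close> and \<open>j\<close> are visible in
      the image, and these are all the vertices of \<open>Q\<close>.\<close>
    by (rule inj_onI, rule extensionalityI[of _ "verts Q"])
      (auto simp: mor sum_mor_eq_iff rep_simps(2) PiE_iff verts)
  assume V: "V \<in> Obj (rep Q k)" and W: "W \<in> Obj (rep Q k)"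
  then have "fd_vectorspace k (space V 1)" "fd_vectorspace k (space V 2)"
    "fd_vectorspace k (space W 1)" "fd_vectorspace k (space W 2)"
    by (auto simp: rep_simps(1) verts)
  then show "on_mor F V W ` Hom (rep Q k) V W = Hom (rep quiver_F k) (on_obj F V) (on_obj F W)"
    unfolding obj[OF V] obj[OF W] by (simp only: Hom_sum_rep hom[OF V W]) (auto simp: mor; blast)
qed (simp_all add: category_rep wf wf_quivers)

text \<open>The two squares at \<gamma> and \<delta> of the four-subspace quiver split into the four
  squares of \<open>quiver_S\<close>.\<close>

lemma fully_faithful_F1:
  fixes k :: "('a, 'c) ring_scheme"
  shows "fully_faithful_functor (rep quiver_S k) (rep quiver_F k) F1"
proof (rule fully_faithful_functor_sum_rep[OF wf_quivers(2), where i = 3 and j = 4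
      and g = "\<lambda>V. pair_map (space V 3) (arrow_map V \<alpha>) (arrow_map V \<beta>)"
      and h = "\<lambda>V. pair_map (space V 4) (arrow_map V \<gamma>) (arrow_map V \<delta>)"])
  fix V W :: "('a, 'v) nat_rep" and l1 l2 l3 l4
  assume VW: "V \<in> Obj (rep quiver_S k)" "W \<in> Obj (rep quiver_S k)"
  then have "arrow_map V \<alpha> \<in> lin_maps k (space V 3) (space V 1)"
    "arrow_map V \<beta> \<in> lin_maps k (space V 3) (space V 2)"
    "arrow_map V \<gamma> \<in> lin_maps k (space V 4) (space V 1)"
    "arrow_map V \<delta> \<in> lin_maps k (space V 4) (space V 2)"
    by (simp_all add: rep_simps(1) quiver_S_def PiE_iff)
  note commute = pair_map_commute_iff[OF this(1,2)] pair_map_commute_iff[OF this(3,4)]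
  show "l1 \<in> lin_maps k (space V 1) (space W 1) \<and> l2 \<in> lin_maps k (space V 2) (space W 2) \<and>
      (l3 \<in> lin_maps k (space V 3) (space W 3) \<and> (\<forall>x\<in>carrier (space V 3).
        dirsum_map (space V 1) (space V 2) l1 l2
          (pair_map (space V 3) (arrow_map V \<alpha>) (arrow_map V \<beta>) x)
        = pair_map (space W 3) (arrow_map W \<alpha>) (arrow_map W \<beta>) (l3 x))) \<and>
      (l4 \<in> lin_maps k (space V 4) (space W 4) \<and> (\<forall>x\<in>carrier (space V 4).
        dirsum_map (space V 1) (space V 2) l1 l2
          (pair_map (space V 4) (arrow_map V \<gamma>) (arrow_map V \<delta>) x)
        = pair_map (space W 4) (arrow_map W \<gamma>) (arrow_map W \<delta>) (l4 x)))
    \<longleftrightarrow> (\<exists>l\<in>Hom (rep quiver_S k) V W. l 1 = l1 \<and> l 2 = l2 \<and> l 3 = l3 \<and> l 4 = l4)"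
    unfolding commute
    \<comment> \<open>The witness is the given family itself, with \<open>undefined\<close> at 0
      because 0 is not a vertex of \<open>quiver_S\<close>; this keeps it extensional.\<close>
    by (auto simp: rep_simps(2) quiver_S_def PiE_iff extensional_def mk_mor_F_def[of undefined]
        intro!: bexI[of _ "mk_mor_F undefined l1 l2 l3 l4"])
qed (auto simp: F1_def sum_rep_def sum_mor_def Let_def rep_simps(1) quiver_S_def PiE_iff
    add_map_incl[where k = k] intro!: pair_map_lin)

text \<open>The identity on \<open>space V 2\<close> in the last arrow forces the component at 4 to
  equal the one at 2, which leaves the square of \<gamma>.\<close>

lemma fully_faithful_F2:
  fixes k :: "('a, 'c) ring_scheme"
  shows "fully_faithful_functor (rep quiver_D k) (rep quiver_F k) F2"
proof (rule fully_faithful_functor_sum_rep[OF wf_quivers(3), where i = 3 and j = 2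
      and g = "\<lambda>V. pair_map (space V 3) (arrow_map V \<alpha>) (arrow_map V \<beta>)"
      and h = "\<lambda>V. pair_map (space V 2) (arrow_map V \<gamma>) (id_map (space V 2))"])
  fix V W :: "('a, 'v) nat_rep" and l1 l2 l3 l4
  assume VW: "V \<in> Obj (rep quiver_D k)" "W \<in> Obj (rep quiver_D k)"
  then have "arrow_map V \<alpha> \<in> lin_maps k (space V 3) (space V 1)"
    "arrow_map V \<beta> \<in> lin_maps k (space V 3) (space V 2)"
    "fd_vectorspace k (space V 2)"
    "arrow_map V \<gamma> \<in> lin_maps k (space V 2) (space V 1)"
    by (simp_all add: rep_simps(1) quiver_D_def PiE_iff)
  note commute = pair_map_commute_iff[OF this(1,2)] pair_map_id2_commute_iff[OF this(3,4)]
  show "l1 \<in> lin_maps k (space V 1) (space W 1) \<and> l2 \<in> lin_maps k (space V 2) (space W 2) \<and>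
      (l3 \<in> lin_maps k (space V 3) (space W 3) \<and> (\<forall>x\<in>carrier (space V 3).
        dirsum_map (space V 1) (space V 2) l1 l2
          (pair_map (space V 3) (arrow_map V \<alpha>) (arrow_map V \<beta>) x)
        = pair_map (space W 3) (arrow_map W \<alpha>) (arrow_map W \<beta>) (l3 x))) \<and>
      (l4 \<in> lin_maps k (space V 2) (space W 2) \<and> (\<forall>x\<in>carrier (space V 2).
        dirsum_map (space V 1) (space V 2) l1 l2
          (pair_map (space V 2) (arrow_map V \<gamma>) (id_map (space V 2)) x)
        = pair_map (space W 2) (arrow_map W \<gamma>) (id_map (space W 2)) (l4 x)))
    \<longleftrightarrow> (\<exists>l\<in>Hom (rep quiver_D k) V W. l 1 = l1 \<and> l 2 = l2 \<and> l 3 = l3 \<and> l 2 = l4)"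
    \<comment> \<open>Absorbing the repeated component presupposes that \<open>l2\<close> is linear;
      \<open>conj_cong\<close> supplies this from the earlier conjunct. The witness is
      \<open>undefined\<close> at 0 and 4, which are not vertices of
      \<open>quiver_D\<close>.\<close>
    by (simp only: commute cong: conj_cong)
      (auto simp: rep_simps(2) quiver_D_def PiE_iff extensional_def mk_mor_F_def[of undefined]
        intro!: bexI[of _ "mk_mor_F undefined l1 l2 l3 undefined"])
qed (auto simp: F2_def sum_rep_def sum_mor_def Let_def rep_simps(1) quiver_D_def PiE_iff
    add_map_incl[where k = k] add_map_incl_id2[where k = k] intro!: pair_map_lin id_map_lin)

text \<open>Both last arrows carry an identity on \<open>space V 2\<close>, so the components at 3
  and 4 both repeat the one at 2.\<close>

lemma fully_faithful_F3:
  fixes k :: "('a, 'c) ring_scheme"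
  shows "fully_faithful_functor (rep quiver_K k) (rep quiver_F k) F3"
proof (rule fully_faithful_functor_sum_rep[OF wf_quivers(4), where i = 2 and j = 2
      and g = "\<lambda>V. pair_map (space V 2) (arrow_map V \<alpha>) (id_map (space V 2))"
      and h = "\<lambda>V. pair_map (space V 2) (arrow_map V \<beta>) (id_map (space V 2))"])
  fix V W :: "('a, 'v) nat_rep" and l1 l2 l3 l4
  assume VW: "V \<in> Obj (rep quiver_K k)" "W \<in> Obj (rep quiver_K k)"
  then have "fd_vectorspace k (space V 2)"
    "arrow_map V \<alpha> \<in> lin_maps k (space V 2) (space V 1)"
    "arrow_map V \<beta> \<in> lin_maps k (space V 2) (space V 1)"
    by (simp_all add: rep_simps(1) quiver_K_def PiE_iff)
  note commute = pair_map_id2_commute_iff[OF this(1,2)] pair_map_id2_commute_iff[OF this(1,3)]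
  show "l1 \<in> lin_maps k (space V 1) (space W 1) \<and> l2 \<in> lin_maps k (space V 2) (space W 2) \<and>
      (l3 \<in> lin_maps k (space V 2) (space W 2) \<and> (\<forall>x\<in>carrier (space V 2).
        dirsum_map (space V 1) (space V 2) l1 l2
          (pair_map (space V 2) (arrow_map V \<alpha>) (id_map (space V 2)) x)
        = pair_map (space W 2) (arrow_map W \<alpha>) (id_map (space W 2)) (l3 x))) \<and>
      (l4 \<in> lin_maps k (space V 2) (space W 2) \<and> (\<forall>x\<in>carrier (space V 2).
        dirsum_map (space V 1) (space V 2) l1 l2
          (pair_map (space V 2) (arrow_map V \<beta>) (id_map (space V 2)) x)
        = pair_map (space W 2) (arrow_map W \<beta>) (id_map (space W 2)) (l4 x)))
    \<longleftrightarrow> (\<exists>l\<in>Hom (rep quiver_K k) V W. l 1 = l1 \<and> l 2 = l2 \<and> l 2 = l3 \<and> l 2 = l4)"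
    by (simp only: commute cong: conj_cong)
      (auto simp: rep_simps(2) quiver_K_def PiE_iff extensional_def mk_mor_F_def[of undefined]
        intro!: bexI[of _ "mk_mor_F undefined l1 l2 undefined undefined"])
qed (auto simp: F3_def sum_rep_def sum_mor_def Let_def rep_simps(1) quiver_K_def PiE_iff
    add_map_incl_id2[where k = k] intro!: pair_map_lin id_map_lin)

text \<open>The identities sit on different summands: the component at 3 repeats the one at 1 and
  leaves the square of \<beta>, the component at 4 repeats the one at 2 and leaves the square of
  \<alpha>.\<close>

lemma fully_faithful_F4:
  fixes k :: "('a, 'c) ring_scheme"
  shows "fully_faithful_functor (rep quiver_C k) (rep quiver_F k) F4"
proof (rule fully_faithful_functor_sum_rep[OF wf_quivers(5), where i = 1 and j = 2
      and g = "\<lambda>V. pair_map (space V 1) (id_map (space V 1)) (arrow_map V \<beta>)"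
      and h = "\<lambda>V. pair_map (space V 2) (arrow_map V \<alpha>) (id_map (space V 2))"])
  fix V W :: "('a, 'v) nat_rep" and l1 l2 l3 l4
  assume VW: "V \<in> Obj (rep quiver_C k)" "W \<in> Obj (rep quiver_C k)"
  then have "fd_vectorspace k (space V 1)"
    "arrow_map V \<beta> \<in> lin_maps k (space V 1) (space V 2)"
    "fd_vectorspace k (space V 2)"
    "arrow_map V \<alpha> \<in> lin_maps k (space V 2) (space V 1)"
    by (simp_all add: rep_simps(1) quiver_C_def PiE_iff)
  note commute = pair_map_id1_commute_iff[OF this(1,2)] pair_map_id2_commute_iff[OF this(3,4)]
  show "l1 \<in> lin_maps k (space V 1) (space W 1) \<and> l2 \<in> lin_maps k (space V 2) (space W 2) \<and>
      (l3 \<in> lin_maps k (space V 1) (space W 1) \<and> (\<forall>x\<in>carrier (space V 1).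
        dirsum_map (space V 1) (space V 2) l1 l2
          (pair_map (space V 1) (id_map (space V 1)) (arrow_map V \<beta>) x)
        = pair_map (space W 1) (id_map (space W 1)) (arrow_map W \<beta>) (l3 x))) \<and>
      (l4 \<in> lin_maps k (space V 2) (space W 2) \<and> (\<forall>x\<in>carrier (space V 2).
        dirsum_map (space V 1) (space V 2) l1 l2
          (pair_map (space V 2) (arrow_map V \<alpha>) (id_map (space V 2)) x)
        = pair_map (space W 2) (arrow_map W \<alpha>) (id_map (space W 2)) (l4 x)))
    \<longleftrightarrow> (\<exists>l\<in>Hom (rep quiver_C k) V W. l 1 = l1 \<and> l 2 = l2 \<and> l 1 = l3 \<and> l 2 = l4)"
    by (simp only: commute cong: conj_cong)
      (auto simp: rep_simps(2) quiver_C_def PiE_iff extensional_def mk_mor_F_def[of undefined]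
        intro!: bexI[of _ "mk_mor_F undefined l1 l2 undefined undefined"])
qed (auto simp: F4_def sum_rep_def sum_mor_def Let_def rep_simps(1) quiver_C_def PiE_iff
    add_map_incl_id1[where k = k] add_map_incl_id2[where k = k] intro!: pair_map_lin id_map_lin)

section \<open>Functors on linear relations\<close>

lemma restrict_dirsum_map_id:
  assumes "VectorSpace.subspace k R (dirsum V W)"
  shows "restrict (dirsum_map V W (id_map V) (id_map W)) R = id_map (subsp (dirsum V W) R)"
  unfolding dirsum_map_id using subspace_carrier[OF assms]
  by (auto simp: id_map_def carrier_subsp fun_eq_iff restrict_def)

text \<open>The first map sends \<open>R\<close> into \<open>S\<close>, so restricting the second
  map to \<open>S\<close> does not change the composite on \<open>R\<close>.\<close>

lemma restrict_dirsum_map_compose: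
  assumes R: "VectorSpace.subspace k R (dirsum U1 U2)"
    and f: "f1 \<in> lin_maps k U1 V1" "f2 \<in> lin_maps k U2 V2"
    and S: "\<And>x y. UPair x y \<in> R \<Longrightarrow> UPair (f1 x) (f2 y) \<in> S"
  shows "restrict (dirsum_map U1 U2 (compose (carrier U1) g1 f1) (compose (carrier U2) g2 f2)) R
    = compose R (restrict (dirsum_map V1 V2 g1 g2) S) (restrict (dirsum_map U1 U2 f1 f2) R)"
proof (rule extensionalityI)
  fix p assume p: "p \<in> R"
  obtain x y where xy: "p = UPair x y" "x \<in> carrier U1" "y \<in> carrier U2"
    using subspace_carrier[OF R p] by (rule dirsum_cases)
  then show "restrict (dirsum_map U1 U2 (compose (carrier U1) g1 f1) (compose (carrier U2) g2 f2)) R p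
      = compose R (restrict (dirsum_map V1 V2 g1 g2) S) (restrict (dirsum_map U1 U2 f1 f2) R) p"
    using p S f by (simp add: compose_eq dirsum_map_eq lin_maps_closed)
qed simp_all

lemma F5_on_obj:
  assumes "fd_vectorspace k V"
  shows "on_obj F5 (V, R) = sum_rep V V V (subsp (dirsum V V) R)
    (pair_map V (id_map V) (id_map V)) (id_map (subsp (dirsum V V) R))"
  using assms by (simp add: F5_def sum_rep_def Let_def add_map_incl_id)

lemma F5_on_mor:
  "on_mor F5 (V, R) (W, S) l = sum_mor V V l l l (restrict (dirsum_map V V l l) R)"
  by (simp add: F5_def sum_mor_def)

text \<open>The arrow at 3 is the diagonal of \<open>V\<close>, which forces the components at 1, 2
  and 3 to be a single map \<open>l\<close>. The arrow at 4 then says that \<open>l\<close>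
  preserves the relation.\<close>

lemma fully_faithful_F5:
  fixes k :: "('a, 'c) ring_scheme"
  shows "fully_faithful_functor (lrel k) (rep quiver_F k) F5"
proof (rule fully_faithful_functorI)
  fix A :: "('a, 'v univ) module \<times> 'v univ set"
  assume "A \<in> Obj (lrel k)"
  then obtain V R where A: "A = (V, R)" and fd: "fd_vectorspace k V"
    and R: "VectorSpace.subspace k R (dirsum V V)"
    by (cases A) (auto simp: lrel_def)
  show "on_obj F5 A \<in> Obj (rep quiver_F k)"
    unfolding A F5_on_obj[OF fd]
    using fd R
    by (intro sum_rep_in_Obj pair_map_lin id_map_lin subsp_incl_lin fd_subspace[OF fd_dirsum])
  show "on_mor F5 A A (Ident (lrel k) A) = Ident (rep quiver_F k) (on_obj F5 A)"
    by (simp add: A F5_on_obj[OF fd] F5_on_mor Ident_sum_rep restrict_dirsum_map_id[OF R])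
      (simp add: lrel_def restrict_dirsum_map_id[OF R])
next
  fix A B E :: "('a, 'v univ) module \<times> 'v univ set" and f g
  assume "A \<in> Obj (lrel k)" "f \<in> Hom (lrel k) A B"
  then obtain U P V R W S where A: "A = (U, P)" "B = (V, R)" "E = (W, S)"
    and fd: "fd_vectorspace k U" and P: "VectorSpace.subspace k P (dirsum U U)"
    and f: "f \<in> lin_maps k U V" "\<And>x y. UPair x y \<in> P \<Longrightarrow> UPair (f x) (f y) \<in> R"
    by (cases A; cases B; cases E) (auto simp: lrel_def)
  show "on_mor F5 A E (Comp (lrel k) A B E g f)
      = Comp (rep quiver_F k) (on_obj F5 A) (on_obj F5 B) (on_obj F5 E)
          (on_mor F5 B E g) (on_mor F5 A B f)"
    unfolding A F5_on_obj[OF fd] F5_on_mor Comp_sum_mor[OF f(1) f(1)] carrier_subsp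
    by (simp add: lrel_def restrict_dirsum_map_compose[OF P f(1) f(1) f(2)])
next
  fix A B :: "('a, 'v univ) module \<times> 'v univ set"
  show "inj_on (on_mor F5 A B) (Hom (lrel k) A B)"
    by (cases A; cases B) (auto intro!: inj_onI simp: F5_on_mor sum_mor_eq_iff)
  assume "A \<in> Obj (lrel k)" "B \<in> Obj (lrel k)"
  then obtain V R W S where A: "A = (V, R)" "B = (W, S)"
    and V: "fd_vectorspace k V" and W: "fd_vectorspace k W"
    and R: "VectorSpace.subspace k R (dirsum V V)"
    by (cases A; cases B) (auto simp: lrel_def)
  note commute = pair_map_id1_commute_iff[OF V id_map_lin[OF V]]
    dirsum_map_subsp[OF R _ _ V V] carrier_subsp
  \<comment> \<open>After the component at 3 is identified with \<open>l1\<close>, this residual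
    square of the diagonal identifies \<open>l2\<close> with \<open>l1\<close>.\<close>
  have diag: "l1 \<in> lin_maps k V W \<Longrightarrow> l2 \<in> lin_maps k V W
      \<Longrightarrow> (\<forall>x\<in>carrier V. l2 (id_map V x) = id_map W (l1 x)) \<longleftrightarrow> l2 = l1" for l1 l2
    by (auto simp: id_map_eq lin_maps_closed intro: lin_maps_eqI)
  show "on_mor F5 A B ` Hom (lrel k) A B = Hom (rep quiver_F k) (on_obj F5 A) (on_obj F5 B)"
    unfolding A F5_on_obj[OF V] F5_on_obj[OF W] Hom_sum_rep[OF V V W W]
    by (simp only: commute diag cong: conj_cong) (auto simp: F5_on_mor lrel_def image_iff)
qed (simp_all add: category_lrel category_rep wf_quivers)

lemma F6_on_obj:
  "on_obj F6 (V1, V2, R1, R2) =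
    sum_rep V1 V2 (subsp (dirsum V1 V2) R1) (subsp (dirsum V1 V2) R2)
      (id_map (subsp (dirsum V1 V2) R1)) (id_map (subsp (dirsum V1 V2) R2))"
  by (simp add: F6_def sum_rep_def Let_def)

lemma F6_on_mor:
  "on_mor F6 (V1, V2, R1, R2) (W1, W2, S1, S2) (l1, l2) = sum_mor V1 V2 l1 l2
    (restrict (dirsum_map V1 V2 l1 l2) R1) (restrict (dirsum_map V1 V2 l1 l2) R2)"
  by (simp add: F6_def sum_mor_def)

text \<open>Both last arrows are inclusions of relations, so \<open>dirsum_map_subsp\<close> applies
  twice: the components at 3 and 4 are determined, and the conditions left are those defining
  morphisms in \<open>lrel22\<close>.\<close>

lemma fully_faithful_F6:
  fixes k :: "('a, 'c) ring_scheme"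
  shows "fully_faithful_functor (lrel22 k) (rep quiver_F k) F6"
proof (rule fully_faithful_functorI)
  fix A :: "('a, 'v univ) module \<times> ('a, 'v univ) module \<times> 'v univ set \<times> 'v univ set"
  assume "A \<in> Obj (lrel22 k)"
  then obtain V1 V2 R1 R2 where A: "A = (V1, V2, R1, R2)"
    and fd: "fd_vectorspace k V1" "fd_vectorspace k V2"
    and R: "VectorSpace.subspace k R1 (dirsum V1 V2)" "VectorSpace.subspace k R2 (dirsum V1 V2)"
    by (cases A) (auto simp: lrel22_def)
  show "on_obj F6 A \<in> Obj (rep quiver_F k)"
    unfolding A F6_on_obj
    using fd R by (intro sum_rep_in_Obj subsp_incl_lin fd_subspace[OF fd_dirsum])
  show "on_mor F6 A A (Ident (lrel22 k) A) = Ident (rep quiver_F k) (on_obj F6 A)"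
    unfolding A F6_on_obj Ident_sum_rep
    by (simp add: lrel22_def F6_on_mor restrict_dirsum_map_id[OF R(1)]
        restrict_dirsum_map_id[OF R(2)])
next
  fix A B E :: "('a, 'v univ) module \<times> ('a, 'v univ) module \<times> 'v univ set \<times> 'v univ set" and f
    and g :: "('v univ \<Rightarrow> 'v univ) \<times> ('v univ \<Rightarrow> 'v univ)"
  assume "A \<in> Obj (lrel22 k)" "f \<in> Hom (lrel22 k) A B"
  then obtain U1 U2 P1 P2 V1 V2 R1 R2 W1 W2 S1 S2 f1 f2 g1 g2
    where A: "A = (U1, U2, P1, P2)" "B = (V1, V2, R1, R2)" "E = (W1, W2, S1, S2)"
      "f = (f1, f2)" "g = (g1, g2)"
    and P: "VectorSpace.subspace k P1 (dirsum U1 U2)" "VectorSpace.subspace k P2 (dirsum U1 U2)"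
    and f: "f1 \<in> lin_maps k U1 V1" "f2 \<in> lin_maps k U2 V2"
      "\<And>x y. UPair x y \<in> P1 \<Longrightarrow> UPair (f1 x) (f2 y) \<in> R1"
      "\<And>x y. UPair x y \<in> P2 \<Longrightarrow> UPair (f1 x) (f2 y) \<in> R2"
    by (cases A; cases B; cases E; cases f; cases g) (auto simp: lrel22_def)
  show "on_mor F6 A E (Comp (lrel22 k) A B E g f)
      = Comp (rep quiver_F k) (on_obj F6 A) (on_obj F6 B) (on_obj F6 E)
          (on_mor F6 B E g) (on_mor F6 A B f)"
    unfolding A F6_on_obj F6_on_mor Comp_sum_mor[OF f(1,2)] carrier_subsp
    by (simp add: lrel22_def F6_on_mor Comp_sum_mor[OF f(1,2)] carrier_subsp
        restrict_dirsum_map_compose[OF P(1) f(1,2,3)]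
        restrict_dirsum_map_compose[OF P(2) f(1,2,4)])
next
  fix A B :: "('a, 'v univ) module \<times> ('a, 'v univ) module \<times> 'v univ set \<times> 'v univ set"
  show "inj_on (on_mor F6 A B) (Hom (lrel22 k) A B)"
    by (cases A; cases B) (auto intro!: inj_onI simp: F6_on_mor sum_mor_eq_iff)
  assume "A \<in> Obj (lrel22 k)" "B \<in> Obj (lrel22 k)"
  then obtain V1 V2 R1 R2 W1 W2 S1 S2
    where A: "A = (V1, V2, R1, R2)" "B = (W1, W2, S1, S2)"
    and V: "fd_vectorspace k V1" "fd_vectorspace k V2"
    and W: "fd_vectorspace k W1" "fd_vectorspace k W2"
    and R: "VectorSpace.subspace k R1 (dirsum V1 V2)" "VectorSpace.subspace k R2 (dirsum V1 V2)"
    by (cases A; cases B) (auto simp: lrel22_def)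
  show "on_mor F6 A B ` Hom (lrel22 k) A B = Hom (rep quiver_F k) (on_obj F6 A) (on_obj F6 B)"
    unfolding A F6_on_obj Hom_sum_rep[OF V W]
    \<comment> \<open>The open premises of \<open>dirsum_map_subsp\<close> are linearity of
      \<open>l1\<close> and \<open>l2\<close>, which \<open>conj_cong\<close> takes from the
      preceding conjuncts.\<close>
    by (simp only: dirsum_map_subsp[OF R(1) _ _ V] dirsum_map_subsp[OF R(2) _ _ V] carrier_subsp
        cong: conj_cong)
      (force simp: F6_on_mor lrel22_def image_iff)
qed (simp_all add: category_lrel22 category_rep wf_quivers)

theorem theorem12:
  fixes k :: "('a, 'c) ring_scheme"
  assumes "field k"
  shows "fully_faithful_functor (rep quiver_S k) (rep quiver_F k) F1
    \<and> fully_faithful_functor (rep quiver_D k) (rep quiver_F k) F2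
    \<and> fully_faithful_functor (rep quiver_K k) (rep quiver_F k) F3
    \<and> fully_faithful_functor (rep quiver_C k) (rep quiver_F k) F4
    \<and> fully_faithful_functor (lrel k) (rep quiver_F k) F5
    \<and> fully_faithful_functor (lrel22 k) (rep quiver_F k) F6"
  by (intro conjI fully_faithful_F1 fully_faithful_F2 fully_faithful_F3 fully_faithful_F4
      fully_faithful_F5 fully_faithful_F6)

end
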